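(* Let $p$ be an odd prime and $r,q\ge1$ integers. Define $\phi:\mathfrak M_{p;r,q}\to(\mathbf Z/p^r\mathbf Z)^\times$ by $\phi(c,s,\lambda)=\lambda\bmod p^r$. Then $\phi$ is a surjective homomorphism with $\ker\phi=[\mathfrak M_{p;r,q},\mathfrak M_{p;r,q}]$, so $$|\mathfrak M_{p;r,q}^{\mathrm{ab}}|=\varphi(p^r)=p^{r-1}(p-1),$$ independently of $q$. By contrast, the projective monomial automorphism group $\mathfrak F_{p,q}$ of the Fourier matrix $F_{p^q}$ has $|\mathfrak F_{p,q}^{\mathrm{ab}}|=p^{q-1}(p-1)$. Hence for $q>r$ the groups $\mathfrak M_{p;r,q}$ and $\mathfrak F_{p,q}$ are non-isomorphic, and $H_{p;r,q}$ and $F_{p^q}$ are monomially inequivalent.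
   Context: $\mathbf Z_p$ is the ring of $p$-adic integers, $R_q=\mathbf Z/p^q\mathbf Z$, $\varphi$ is Euler's totient function, $[G,G]$ is the commutator subgroup of a group $G$, and $G^{\mathrm{ab}}=G/[G,G]$. Fix a faithful (injective) character $\chi$ of the cyclic group $(1+p^r\mathbf Z_p)/(1+p^{q+r}\mathbf Z_p)$; $H_{p;r,q}$ is the matrix with entries $\chi(1+p^rab)$, $a,b\in R_q$. The Fourier matrix is $F_{p^q}(a,b)=\exp(2\pi i\,ab/p^q)$, $a,b\in R_q$. For a matrix $H$ on $R_q\times R_q$ with unimodular entries and rows $H_a(b)$, its projective monomial automorphism group consists of quadruples $(\pi,\sigma,\alpha,\omega)$ of permutations $\pi,\sigma$ of $R_q$ and unimodular complex functions $\alpha,\omega$ on $R_q$ with $H_a(\sigma(b))\omega(b)=\alpha_aH_{\pi(a)}(b)$ for all $a,b$, modulo $(\pi,\sigma,\alpha,\omega)\sim(\pi,\sigma,\zeta\alpha,\zeta\omega)$, $|\zeta|=1$; the product of two elements has row permutation $\pi\circ\pi'$ and column permutation $\sigma'\circ\sigma$ (composition of the operators $f\mapsto\omega\cdot(f\circ\sigma)$). For $H=H_{p;r,q}$ this group is $\mathfrak M_{p;r,q}$; for $F_{p^q}$ it is $\mathfrak F_{p,q}$. Each element of $\mathfrak M_{p;r,q}$ is given by a unique triple $(c,s,\lambda)\in R_q\times R_q\times R_q^\times$ through $\sigma(b)=\frac{s+\lambda b}{1+p^rcb}$, $\pi(a)=\frac{c+\lambda a}{1+p^rsa}$, $\omega(b)=H_c(b)$,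 $\alpha_a=H_a(s)$; every triple occurs; and $$(c,s,\lambda)\cdot(c',s',\lambda')=\left(\frac{c+\lambda c'}{u},\frac{\lambda's+s'}{u},\frac{\lambda\lambda'+p^rcs'}{u}\right),\quad u=1+p^rsc'.$$ Matrices $H,K$ are monomially equivalent if $K=D_1PHQD_2$ with $P,Q$ permutation matrices and $D_1,D_2$ diagonal with unimodular diagonal entries.
   Formalization: The claims about φ, its kernel and |M^ab| are stated for r ≤ q only: for r > q, λ mod p^r is undefined for λ in R_q^× and |M^ab| = p^{q-1}(p-1), not p^{r-1}(p-1) (e.g. p=3, r=2, q=1 gives 2, not 6). *)

theory Defs
  imports
    "HOL-Algebra.Generated_Groups"
    "HOL-Combinatorics.Permutations"
    "HOL-Number_Theory.Number_Theory"
    Complex_Main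
begin

subsection \<open>The $p$-adic integers and their principal units\<close>

text \<open>
  $\mathbf{Z}_p$ as the inverse limit of the rings $\mathbf{Z}/p^n\mathbf{Z}$: the entry \<open>x n\<close>
  of a coherent sequence is the residue of \<open>x\<close> modulo \<open>p ^ n\<close>, in \<open>{0..<p ^ n}\<close>.
\<close>

definition padic_ring :: "nat \<Rightarrow> (nat \<Rightarrow> int) ring" where
  "padic_ring p =
     \<lparr>carrier = {x. \<forall>n. x n \<in> {0..<int p ^ n} \<and> x (Suc n) mod int p ^ n = x n},
      monoid.mult = \<lambda>x y n. (x n * y n) mod int p ^ n,
      one = \<lambda>n. 1 mod int p ^ n,
      zero = \<lambda>n. 0,
      add = \<lambda>x y n. (x n + y n) mod int p ^ n\<rparr>"

definition padic_of_int :: "nat \<Rightarrow> int \<Rightarrow> nat \<Rightarrow> int" where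
  "padic_of_int p m = (\<lambda>n. m mod int p ^ n)"

text \<open>The set $1 + p^k\mathbf{Z}_p$.\<close>

definition principal_units :: "nat \<Rightarrow> nat \<Rightarrow> (nat \<Rightarrow> int) set" where
  "principal_units p k =
     {\<one>\<^bsub>padic_ring p\<^esub> \<oplus>\<^bsub>padic_ring p\<^esub> (padic_of_int p (int p ^ k) \<otimes>\<^bsub>padic_ring p\<^esub> z) |z.
        z \<in> carrier (padic_ring p)}"

definition principal_unit_group :: "nat \<Rightarrow> nat \<Rightarrow> (nat \<Rightarrow> int) monoid" where
  "principal_unit_group p k =
     \<lparr>carrier = principal_units p k, monoid.mult = monoid.mult (padic_ring p), one = one (padic_ring p)\<rparr>"

text \<open>The cyclic group $(1+p^r\mathbf{Z}_p)/(1+p^{q+r}\mathbf{Z}_p)$; its elements are cosets.\<close>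

definition principal_unit_quotient :: "nat \<Rightarrow> nat \<Rightarrow> nat \<Rightarrow> (nat \<Rightarrow> int) set monoid" where
  "principal_unit_quotient p r q = principal_unit_group p r Mod principal_units p (q + r)"

definition principal_unit_class :: "nat \<Rightarrow> nat \<Rightarrow> nat \<Rightarrow> int \<Rightarrow> (nat \<Rightarrow> int) set" where
  "principal_unit_class p r q m =
     principal_units p (q + r) #>\<^bsub>principal_unit_group p r\<^esub> padic_of_int p m"

definition complex_unit_group :: "complex monoid" where
  "complex_unit_group = \<lparr>carrier = - {0}, monoid.mult = (*), one = 1\<rparr>"

definition faithful_character :: "('a, 'b) monoid_scheme \<Rightarrow> ('a \<Rightarrow> complex) \<Rightarrow> bool" where
  "faithful_character G \<chi> \<longleftrightarrow> \<chi> \<in> hom G complex_unit_group \<and> inj_on \<chi> (carrier G)"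


subsection \<open>The two matrices\<close>

abbreviation res_set :: "nat \<Rightarrow> nat \<Rightarrow> int set" where
  "res_set p q \<equiv> carrier (residue_ring (int p ^ q))"

abbreviation res_units :: "nat \<Rightarrow> nat \<Rightarrow> int set" where
  "res_units p q \<equiv> Units (residue_ring (int p ^ q))"

text \<open>
  Matrices on \<open>R \<times> R\<close> with \<open>R = \<int>/p\<^sup>q\<int>\<close> are functions evaluated on the residues \<open>{0..p ^ q - 1}\<close>
  (the carrier of \<^const>\<open>residue_ring\<close>).  Both formulas below depend on the arguments modulo
  \<open>p ^ q\<close> only.
\<close>

definition H_matrix :: "nat \<Rightarrow> nat \<Rightarrow> nat \<Rightarrow> ((nat \<Rightarrow> int) set \<Rightarrow> complex) \<Rightarrow> int \<Rightarrow> int \<Rightarrow> complex" where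
  "H_matrix p r q \<chi> a b = \<chi> (principal_unit_class p r q (1 + int p ^ r * a * b))"

definition Fourier_matrix :: "nat \<Rightarrow> nat \<Rightarrow> int \<Rightarrow> int \<Rightarrow> complex" where
  "Fourier_matrix p q a b = exp (2 * of_real pi * \<i> * of_int (a * b) / of_nat (p ^ q))"


subsection \<open>Projective monomial automorphism groups\<close>

type_synonym 'i quad = "('i \<Rightarrow> 'i) \<times> ('i \<Rightarrow> 'i) \<times> ('i \<Rightarrow> complex) \<times> ('i \<Rightarrow> complex)"

text \<open>
  The quadruples \<open>(\<pi>, \<sigma>, \<alpha>, \<omega>)\<close>.  To make them unique as HOL objects, permutations of \<open>I\<close> are the
  identity and scalar functions on \<open>I\<close> are \<^const>\<open>undefined\<close> outside \<open>I\<close>.  The product is the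
  composition \<open>T \<circ> T'\<close> of the operators \<open>T f = \<omega> \<cdot> (f \<circ> \<sigma>)\<close>: since \<open>T H\<^sub>a = \<alpha>\<^sub>a H\<^bsub>\<pi> a\<^esub>\<close>, one has
  \<open>T (T' H\<^sub>a) = \<alpha>'\<^sub>a \<alpha>\<^bsub>\<pi>' a\<^esub> H\<^bsub>\<pi> (\<pi>' a)\<^esub>\<close> and \<open>T (T' f) = \<omega> \<cdot> (\<omega>' \<circ> \<sigma>) \<cdot> (f \<circ> \<sigma>' \<circ> \<sigma>)\<close>.
\<close>

definition monomial_group :: "'i set \<Rightarrow> ('i \<Rightarrow> 'i \<Rightarrow> complex) \<Rightarrow> 'i quad monoid" where
  "monomial_group I H =
     \<lparr>carrier = {(\<pi>, \<sigma>, \<alpha>, \<omega>). \<pi> permutes I \<and> \<sigma> permutes I \<and>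
         \<alpha> \<in> I \<rightarrow>\<^sub>E {z. cmod z = 1} \<and> \<omega> \<in> I \<rightarrow>\<^sub>E {z. cmod z = 1} \<and>
         (\<forall>a\<in>I. \<forall>b\<in>I. H a (\<sigma> b) * \<omega> b = \<alpha> a * H (\<pi> a) b)},
      monoid.mult = \<lambda>(\<pi>, \<sigma>, \<alpha>, \<omega>) (\<pi>', \<sigma>', \<alpha>', \<omega>').
         (\<pi> \<circ> \<pi>', \<sigma>' \<circ> \<sigma>, \<lambda>a\<in>I. \<alpha>' a * \<alpha> (\<pi>' a), \<lambda>b\<in>I. \<omega> b * \<omega>' (\<sigma> b)),
      one = (id, id, \<lambda>a\<in>I. 1, \<lambda>b\<in>I. 1)\<rparr>"

definition monomial_scalars :: "'i set \<Rightarrow> 'i quad set" where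
  "monomial_scalars I = {(id, id, \<lambda>a\<in>I. \<zeta>, \<lambda>b\<in>I. \<zeta>) |\<zeta>. cmod \<zeta> = 1}"

text \<open>
  The coset of \<open>(\<pi>, \<sigma>, \<alpha>, \<omega>)\<close> is the set of all \<open>(\<pi>, \<sigma>, \<zeta>\<alpha>, \<zeta>\<omega>)\<close> with \<open>\<bar>\<zeta>\<bar> = 1\<close>, so that this is
  the group of quadruples modulo \<open>\<sim>\<close>.
\<close>

definition projective_monomial_group :: "'i set \<Rightarrow> ('i \<Rightarrow> 'i \<Rightarrow> complex) \<Rightarrow> 'i quad set monoid" where
  "projective_monomial_group I H = monomial_group I H Mod monomial_scalars I"

lemma group_monomial_group: "group (monomial_group I H)"
proof (rule groupI)
  fix x y assume x: "x \<in> carrier (monomial_group I H)" and y: "y \<in> carrier (monomial_group I H)"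
  obtain p s a w p' s' a' w' where xy: "x = (p, s, a, w)" "y = (p', s', a', w')"
    by (metis prod_cases4)
  have P: "p permutes I" "s permutes I" "p' permutes I" "s' permutes I"
    and U: "a \<in> I \<rightarrow>\<^sub>E {z. cmod z = 1}" "w \<in> I \<rightarrow>\<^sub>E {z. cmod z = 1}"
      "a' \<in> I \<rightarrow>\<^sub>E {z. cmod z = 1}" "w' \<in> I \<rightarrow>\<^sub>E {z. cmod z = 1}"
    and E: "\<And>i j. i \<in> I \<Longrightarrow> j \<in> I \<Longrightarrow> H i (s j) * w j = a i * H (p i) j"
    and E': "\<And>i j. i \<in> I \<Longrightarrow> j \<in> I \<Longrightarrow> H i (s' j) * w' j = a' i * H (p' i) j"
    using x y by (auto simp: xy monomial_group_def)
  have "H i (s' (s j)) * (w j * w' (s j)) = (a' i * a (p' i)) * H (p (p' i)) j"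
    if "i \<in> I" "j \<in> I" for i j
  proof -
    have "s j \<in> I" "p' i \<in> I"
      using that P by (auto simp: permutes_in_image)
    then have "H i (s' (s j)) * (w j * w' (s j)) = a' i * (H (p' i) (s j) * w j)"
      using E'[OF \<open>i \<in> I\<close>, of "s j"] by (simp add: mult_ac)
    also have "\<dots> = a' i * (a (p' i) * H (p (p' i)) j)"
      using E[OF \<open>p' i \<in> I\<close> \<open>j \<in> I\<close>] by simp
    finally show ?thesis
      by (simp add: mult_ac)
  qed
  then show "x \<otimes>\<^bsub>monomial_group I H\<^esub> y \<in> carrier (monomial_group I H)"
    using P U by (auto simp: xy monomial_group_def permutes_compose PiE_iff norm_mult permutes_in_image)
next
  show "\<one>\<^bsub>monomial_group I H\<^esub> \<in> carrier (monomial_group I H)"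
    by (auto simp: monomial_group_def permutes_id)
next
  fix x y z
  assume "x \<in> carrier (monomial_group I H)" "y \<in> carrier (monomial_group I H)"
    "z \<in> carrier (monomial_group I H)"
  then show "x \<otimes>\<^bsub>monomial_group I H\<^esub> y \<otimes>\<^bsub>monomial_group I H\<^esub> z =
    x \<otimes>\<^bsub>monomial_group I H\<^esub> (y \<otimes>\<^bsub>monomial_group I H\<^esub> z)"
    by (auto simp: monomial_group_def o_assoc permutes_in_image mult_ac intro!: restrict_ext)
next
  fix x assume "x \<in> carrier (monomial_group I H)"
  then show "\<one>\<^bsub>monomial_group I H\<^esub> \<otimes>\<^bsub>monomial_group I H\<^esub> x = x"
    by (auto simp: monomial_group_def permutes_in_image PiE_iff extensional_def restrict_def fun_eq_iff)
next
  fix x assume x: "x \<in> carrier (monomial_group I H)"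
  obtain p s a w where xy: "x = (p, s, a, w)"
    by (metis prod_cases4)
  have P: "p permutes I" "s permutes I"
    and U: "a \<in> I \<rightarrow>\<^sub>E {z. cmod z = 1}" "w \<in> I \<rightarrow>\<^sub>E {z. cmod z = 1}"
    and E: "\<And>i j. i \<in> I \<Longrightarrow> j \<in> I \<Longrightarrow> H i (s j) * w j = a i * H (p i) j"
    using x by (auto simp: xy monomial_group_def)
  have P': "inv_into UNIV p permutes I" "inv_into UNIV s permutes I"
    using P by (auto intro: permutes_inv)
  have nz: "a i \<noteq> 0" "w i \<noteq> 0" if "i \<in> I" for i
    using U that by (auto simp: PiE_iff)
  define y where "y = (inv_into UNIV p, inv_into UNIV s, \<lambda>i\<in>I. inverse (a (inv_into UNIV p i)), \<lambda>i\<in>I. inverse (w (inv_into UNIV s i)))"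
  have "H i (inv_into UNIV s j) * inverse (w (inv_into UNIV s j)) = inverse (a (inv_into UNIV p i)) * H (inv_into UNIV p i) j"
    if "i \<in> I" "j \<in> I" for i j
  proof -
    have I: "inv_into UNIV p i \<in> I" "inv_into UNIV s j \<in> I"
      using that P' by (auto simp: permutes_in_image)
    have "H (inv_into UNIV p i) j * w (inv_into UNIV s j) = a (inv_into UNIV p i) * H i (inv_into UNIV s j)"
      using E[OF I] P by (simp add: permutes_inverses)
    then show ?thesis
      using nz I by (simp add: field_simps)
  qed
  then have "y \<in> carrier (monomial_group I H)"
    using P' U by (auto simp: y_def monomial_group_def PiE_iff norm_inverse permutes_in_image)
  moreover have "y \<otimes>\<^bsub>monomial_group I H\<^esub> x = \<one>\<^bsub>monomial_group I H\<^esub>"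
    using P P' nz by (auto simp: xy y_def monomial_group_def permutes_inv_o permutes_in_image
        permutes_inverses intro!: restrict_ext)
  ultimately show "\<exists>y\<in>carrier (monomial_group I H). y \<otimes>\<^bsub>monomial_group I H\<^esub> x = \<one>\<^bsub>monomial_group I H\<^esub>"
    by blast
qed

lemma normal_monomial_scalars: "monomial_scalars I \<lhd> monomial_group I H"
proof -
  interpret group "monomial_group I H"
    by (rule group_monomial_group)
  have sub: "monomial_scalars I \<subseteq> carrier (monomial_group I H)"
    by (auto simp: monomial_scalars_def monomial_group_def permutes_id)
  have central: "h \<otimes>\<^bsub>monomial_group I H\<^esub> x = x \<otimes>\<^bsub>monomial_group I H\<^esub> h"
    if "h \<in> monomial_scalars I" "x \<in> carrier (monomial_group I H)" for h x
    using that by (auto simp: monomial_scalars_def monomial_group_def permutes_in_image intro!: restrict_ext)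
  have mult: "(id, id, \<lambda>a\<in>I. z, \<lambda>b\<in>I. z) \<otimes>\<^bsub>monomial_group I H\<^esub> (id, id, \<lambda>a\<in>I. z', \<lambda>b\<in>I. z') =
      (id, id, \<lambda>a\<in>I. z * z', \<lambda>b\<in>I. z * z')" for z z'
    by (auto simp: monomial_group_def intro!: restrict_ext)
  have "subgroup (monomial_scalars I) (monomial_group I H)"
  proof (rule subgroupI)
    show "monomial_scalars I \<noteq> {}"
      unfolding monomial_scalars_def using norm_one by blast
  next
    fix h assume h: "h \<in> monomial_scalars I"
    then obtain z where z: "h = (id, id, \<lambda>a\<in>I. z, \<lambda>b\<in>I. z)" "cmod z = 1"
      by (auto simp: monomial_scalars_def)
    let ?g = "(id, id, \<lambda>a\<in>I. inverse z, \<lambda>b\<in>I. inverse z) :: 'a quad"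
    have g: "?g \<in> monomial_scalars I"
      unfolding monomial_scalars_def using z norm_inverse[of z] by (auto intro!: exI[of _ "inverse z"])
    have "z \<noteq> 0"
      using z by auto
    then have "?g \<otimes>\<^bsub>monomial_group I H\<^esub> h = \<one>\<^bsub>monomial_group I H\<^esub>"
      unfolding z mult by (simp add: monomial_group_def)
    then have "inv\<^bsub>monomial_group I H\<^esub> h = ?g"
      using g h sub by (intro inv_equality) auto
    then show "inv\<^bsub>monomial_group I H\<^esub> h \<in> monomial_scalars I"
      using g by simp
  next
    fix h k assume "h \<in> monomial_scalars I" "k \<in> monomial_scalars I"
    then obtain z z' where "h = (id, id, \<lambda>a\<in>I. z, \<lambda>b\<in>I. z)" "cmod z = 1"
      "k = (id, id, \<lambda>a\<in>I. z', \<lambda>b\<in>I. z')" "cmod z' = 1"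
      by (auto simp: monomial_scalars_def)
    then show "h \<otimes>\<^bsub>monomial_group I H\<^esub> k \<in> monomial_scalars I"
      by (simp only: mult) (auto simp: monomial_scalars_def norm_mult intro!: exI[of _ "z * z'"])
  qed (use sub in auto)
  then show ?thesis
    by (rule normalI) (use central sub in \<open>auto simp: r_coset_def l_coset_def\<close>)
qed

corollary group_projective_monomial_group: "group (projective_monomial_group I H)"
  unfolding projective_monomial_group_def
  by (intro normal.factorgroup_is_group normal_monomial_scalars)

definition M_group ::
    "nat \<Rightarrow> nat \<Rightarrow> nat \<Rightarrow> ((nat \<Rightarrow> int) set \<Rightarrow> complex) \<Rightarrow> int quad set monoid" where
  "M_group p r q \<chi> = projective_monomial_group (res_set p q) (H_matrix p r q \<chi>)"

definition F_group :: "nat \<Rightarrow> nat \<Rightarrow> int quad set monoid" where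
  "F_group p q = projective_monomial_group (res_set p q) (Fourier_matrix p q)"


subsection \<open>The coordinates on \<open>M_group\<close> and the map \<open>\<phi>\<close>\<close>

text \<open>The permutation \<open>b \<mapsto> (t + \<lambda>b) / (1 + p\<^sup>rub)\<close> of \<open>\<int>/p\<^sup>q\<int>\<close>.\<close>

definition mobius_perm :: "nat \<Rightarrow> nat \<Rightarrow> nat \<Rightarrow> int \<Rightarrow> int \<Rightarrow> int \<Rightarrow> int \<Rightarrow> int" where
  "mobius_perm p r q u t l b =
     (if b \<in> res_set p q
      then (t + l * b) * modular_inverse (int p ^ q) (1 + int p ^ r * u * b) mod int p ^ q
      else b)"

definition M_element ::
    "nat \<Rightarrow> nat \<Rightarrow> nat \<Rightarrow> ((nat \<Rightarrow> int) set \<Rightarrow> complex) \<Rightarrow> int \<times> int \<times> int \<Rightarrow> int quad set" where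
  "M_element p r q \<chi> = (\<lambda>(c, s, l).
     monomial_scalars (res_set p q) #>\<^bsub>monomial_group (res_set p q) (H_matrix p r q \<chi>)\<^esub>
       (mobius_perm p r q s c l, mobius_perm p r q c s l,
        \<lambda>a\<in>res_set p q. H_matrix p r q \<chi> a s, \<lambda>b\<in>res_set p q. H_matrix p r q \<chi> c b))"

text \<open>
  Each element of \<^const>\<open>M_group\<close> is \<open>M_element p r q \<chi> (c, s, l)\<close> for exactly one triple
  in \<open>R \<times> R \<times> R\<^sup>\<times>\<close>; these are its coordinates.
\<close>

definition M_coords ::
    "nat \<Rightarrow> nat \<Rightarrow> nat \<Rightarrow> ((nat \<Rightarrow> int) set \<Rightarrow> complex) \<Rightarrow> int quad set \<Rightarrow> int \<times> int \<times> int" where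
  "M_coords p r q \<chi> =
     the_inv_into (res_set p q \<times> res_set p q \<times> res_units p q) (M_element p r q \<chi>)"

text \<open>
  Reduction modulo \<open>p ^ r\<close> is a function of \<open>l \<in> \<int>/p\<^sup>q\<int>\<close> only if \<open>r \<le> q\<close>; for \<open>r > q\<close> this
  reduces the representative in \<open>{0..p ^ q - 1}\<close> and has no intrinsic meaning.
\<close>

definition phi :: "nat \<Rightarrow> nat \<Rightarrow> nat \<Rightarrow> ((nat \<Rightarrow> int) set \<Rightarrow> complex) \<Rightarrow> int quad set \<Rightarrow> int" where
  "phi p r q \<chi> X = (case M_coords p r q \<chi> X of (c, s, l) \<Rightarrow> l mod int p ^ r)"

definition abelianization :: "('a, 'b) monoid_scheme \<Rightarrow> 'a set monoid" where
  "abelianization G = G Mod derived G (carrier G)"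


subsection \<open>Monomial equivalence\<close>

text \<open>Matrices indexed by a finite set \<open>I\<close>, compared on \<open>I \<times> I\<close> only.\<close>

definition mat_prod ::
    "'i set \<Rightarrow> ('i \<Rightarrow> 'i \<Rightarrow> complex) \<Rightarrow> ('i \<Rightarrow> 'i \<Rightarrow> complex) \<Rightarrow> 'i \<Rightarrow> 'i \<Rightarrow> complex" where
  "mat_prod I A B a b = (\<Sum>c\<in>I. A a c * B c b)"

definition perm_matrix :: "('i \<Rightarrow> 'i) \<Rightarrow> 'i \<Rightarrow> 'i \<Rightarrow> complex" where
  "perm_matrix \<pi> a b = (if b = \<pi> a then 1 else 0)"

definition diag_matrix :: "('i \<Rightarrow> complex) \<Rightarrow> 'i \<Rightarrow> 'i \<Rightarrow> complex" where
  "diag_matrix d a b = (if a = b then d a else 0)"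

definition monomially_equivalent ::
    "'i set \<Rightarrow> ('i \<Rightarrow> 'i \<Rightarrow> complex) \<Rightarrow> ('i \<Rightarrow> 'i \<Rightarrow> complex) \<Rightarrow> bool" where
  "monomially_equivalent I H K \<longleftrightarrow>
     (\<exists>\<pi> \<sigma> d\<^sub>1 d\<^sub>2. \<pi> permutes I \<and> \<sigma> permutes I \<and>
        (\<forall>a\<in>I. cmod (d\<^sub>1 a) = 1) \<and> (\<forall>b\<in>I. cmod (d\<^sub>2 b) = 1) \<and>
        (\<forall>a\<in>I. \<forall>b\<in>I. K a b =
           mat_prod I (diag_matrix d\<^sub>1) (mat_prod I (perm_matrix \<pi>) (mat_prod I H
             (mat_prod I (perm_matrix \<sigma>) (diag_matrix d\<^sub>2)))) a b))"

end

theory Submission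
  imports Defs
begin

text \<open>
  Both matrices have entries \<open>h (a * b)\<close> for some \<open>h\<close> on \<open>\<int>/p\<^sup>q\<int>\<close> that is injective and satisfies the
  deformed additivity \<open>h x * h y = h (x + y + p\<^sup>r * x * y)\<close>; for the Fourier matrix take \<open>r = q\<close>, where the
  deformation vanishes.  Hence one computation of the abelianization covers \<open>M\<close> (exponent \<open>r\<close>) and
  \<open>F\<close> (exponent \<open>q\<close>).  The shifts \<open>(c, 0, 1)\<close> and \<open>(0, s, 1)\<close> are commutators involving \<open>(0, 0, 2)\<close>, since
  \<open>2 - 1\<close> is a unit.  Writing \<open>(0, 1, 1) \<cdot> (c, 0, 1)\<close> as row shift times diagonal times column shift
  produces the diagonal element \<open>(0, 0, v\<^sup>2)\<close> with \<open>v = 1 / (1 + p\<^sup>r c)\<close>, and as \<open>p\<close> is odd every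
  \<open>w \<equiv> 1 (mod p\<^sup>r)\<close> is such a square.  So the commutator subgroup is all of \<open>\<lambda> \<equiv> 1 (mod p\<^sup>r)\<close>.

  For the inequivalence, an equivalence normalised at the indices going to \<open>0\<close> turns additivity
  of the Fourier rows into an \<open>X\<close> with \<open>X * y \<equiv> 2 * y + p\<^sup>r * y\<^sup>2 (mod p\<^sup>q)\<close> for all \<open>y\<close>; the values
  \<open>y = 1, 2\<close> force \<open>q \<le> r\<close>.
\<close>

subsection \<open>Integers in the principal unit quotient\<close>

lemma padic_ring_simps:
  "x \<in> carrier (padic_ring p) \<longleftrightarrow> (\<forall>n. x n \<in> {0..<int p ^ n} \<and> x (Suc n) mod int p ^ n = x n)"
  "x \<otimes>\<^bsub>padic_ring p\<^esub> y = (\<lambda>n. (x n * y n) mod int p ^ n)"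
  "x \<oplus>\<^bsub>padic_ring p\<^esub> y = (\<lambda>n. (x n + y n) mod int p ^ n)"
  "\<one>\<^bsub>padic_ring p\<^esub> = (\<lambda>n. 1 mod int p ^ n)"
  by (simp_all add: padic_ring_def)

lemma mod_power_Suc_mod: "(x mod int p ^ Suc n) mod int p ^ n = x mod int p ^ n"
  by (simp add: mod_mod_cancel)

lemma padic_of_int_carrier: "p > 0 \<Longrightarrow> padic_of_int p m \<in> carrier (padic_ring p)"
  by (simp add: padic_ring_simps padic_of_int_def mod_power_Suc_mod del: power_Suc)

lemma padic_mod_power:
  assumes "x \<in> carrier (padic_ring p)"
  shows "x (k + n) mod int p ^ n = x n"
proof (induction k)
  case 0
  then show ?case using assms by (simp add: padic_ring_simps)
next
  case (Suc k)
  have "x (Suc (k + n)) mod int p ^ n = (x (Suc (k + n)) mod int p ^ (k + n)) mod int p ^ n"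
    by (simp add: mod_mod_cancel le_imp_power_dvd)
  also have "\<dots> = x (k + n) mod int p ^ n"
    using assms by (simp add: padic_ring_simps)
  finally show ?case using Suc by simp
qed

lemma padic_mult_closed:
  assumes "p > 0" "x \<in> carrier (padic_ring p)" "y \<in> carrier (padic_ring p)"
  shows "x \<otimes>\<^bsub>padic_ring p\<^esub> y \<in> carrier (padic_ring p)"
proof -
  have "(x (Suc n) * y (Suc n) mod int p ^ Suc n) mod int p ^ n = x n * y n mod int p ^ n" for n
  proof -
    have "(x (Suc n) * y (Suc n) mod int p ^ Suc n) mod int p ^ n =
        (x (Suc n) mod int p ^ n) * (y (Suc n) mod int p ^ n) mod int p ^ n"
      unfolding mod_power_Suc_mod by (simp add: mod_mult_eq)
    then show ?thesis using assms by (simp add: padic_ring_simps)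
  qed
  then show ?thesis using assms by (simp add: padic_ring_simps(1,2))
qed

lemma padic_mult_comm: "x \<otimes>\<^bsub>padic_ring p\<^esub> y = y \<otimes>\<^bsub>padic_ring p\<^esub> x"
  by (simp add: padic_ring_simps mult.commute)

lemma padic_mult_assoc:
  "x \<otimes>\<^bsub>padic_ring p\<^esub> y \<otimes>\<^bsub>padic_ring p\<^esub> z = x \<otimes>\<^bsub>padic_ring p\<^esub> (y \<otimes>\<^bsub>padic_ring p\<^esub> z)"
  by (simp add: padic_ring_simps mod_simps mult.assoc)

lemma padic_one_mult: "x \<in> carrier (padic_ring p) \<Longrightarrow> \<one>\<^bsub>padic_ring p\<^esub> \<otimes>\<^bsub>padic_ring p\<^esub> x = x"
  by (auto simp add: padic_ring_simps mod_simps fun_eq_iff)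

lemma padic_of_int_mult:
  "padic_of_int p m \<otimes>\<^bsub>padic_ring p\<^esub> padic_of_int p n = padic_of_int p (m * n)"
  by (simp add: padic_ring_simps padic_of_int_def mod_simps)

text \<open>Replaces the existential description of 1 + p^k Z_p by a condition on the single entry
  k: coherence passes x = 1 modulo p^k on to all later entries, so x - 1 can be divided by p^k
  there.\<close>

lemma principal_units_iff:
  assumes "p > 0"
  shows "x \<in> principal_units p k \<longleftrightarrow> x \<in> carrier (padic_ring p) \<and> [x k = 1] (mod int p ^ k)"
proof safe
  assume "x \<in> principal_units p k"
  then obtain z where z: "z \<in> carrier (padic_ring p)"
    and x: "x = (\<lambda>n. (1 + int p ^ k * z n) mod int p ^ n)"
    by (auto simp: principal_units_def padic_ring_simps(2,3,4) padic_of_int_def mod_simps)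
  have "x (Suc n) mod int p ^ n = x n" for n
  proof -
    have "x (Suc n) mod int p ^ n = (1 + int p ^ k * (z (Suc n) mod int p ^ n)) mod int p ^ n"
      unfolding x mod_power_Suc_mod by (metis mod_add_right_eq mod_mult_right_eq)
    then show ?thesis using z by (simp add: x padic_ring_simps)
  qed
  then show "x \<in> carrier (padic_ring p)"
    using assms by (simp add: padic_ring_simps x del: power_Suc)
  show "[x k = 1] (mod int p ^ k)"
    by (simp add: x cong_def mod_simps)
next
  assume x: "x \<in> carrier (padic_ring p)" and c: "[x k = 1] (mod int p ^ k)"
  \<comment> \<open>Division by p^k costs k digits of precision, so entry n of the quotient is read
    off from entry n + k of x.\<close>
  define z where "z = (\<lambda>n. ((x (n + k) - 1) div int p ^ k) mod int p ^ n)"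
  have ck: "[x (n + k) = 1] (mod int p ^ k)" for n
    using c padic_mod_power[OF x, of n k] by (metis cong_def mod_mod_trivial)
  then have eq: "int p ^ k * ((x (n + k) - 1) div int p ^ k) = x (n + k) - 1" for n
    by (simp add: cong_iff_dvd_diff)
  have "[(x (Suc n + k) - 1) div int p ^ k = (x (n + k) - 1) div int p ^ k] (mod int p ^ n)" for n
  proof -
    have "x (Suc n + k) mod int p ^ (n + k) = x (n + k)"
      using x by (simp add: padic_ring_simps)
    then have "[x (Suc n + k) = x (n + k)] (mod int p ^ (n + k))"
      by (metis cong_mod_right cong_refl)
    then have "int p ^ k * int p ^ n dvd
        int p ^ k * ((x (Suc n + k) - 1) div int p ^ k - (x (n + k) - 1) div int p ^ k)"
      unfolding right_diff_distrib eq by (simp add: cong_iff_dvd_diff power_add mult.commute)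
    then show ?thesis
      using assms by (simp add: cong_iff_dvd_diff)
  qed
  then have "z \<in> carrier (padic_ring p)"
    using assms by (simp add: padic_ring_simps z_def mod_power_Suc_mod cong_def del: power_Suc)
  moreover have "x n = (1 + int p ^ k * z n) mod int p ^ n" for n
  proof -
    have "(1 + int p ^ k * z n) mod int p ^ n = x (n + k) mod int p ^ n"
      using eq[of n] unfolding z_def
      by (metis (no_types, lifting) add.commute diff_add_cancel mod_add_right_eq mod_mult_right_eq)
    then show ?thesis
      using padic_mod_power[OF x, of k n] by (simp add: add.commute)
  qed
  ultimately show "x \<in> principal_units p k"
    by (auto simp: principal_units_def padic_ring_simps(2,3,4) padic_of_int_def mod_simps fun_eq_iff)
qed

lemma principal_units_mult:
  assumes "p > 0" "x \<in> principal_units p k" "y \<in> principal_units p k"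
  shows "x \<otimes>\<^bsub>padic_ring p\<^esub> y \<in> principal_units p k"
proof -
  have "[x k * y k = 1 * 1] (mod int p ^ k)"
    using assms by (intro cong_mult) (auto simp: principal_units_iff)
  then show ?thesis
    using assms by (simp add: principal_units_iff padic_mult_closed) (simp add: padic_ring_simps)
qed

lemma one_in_principal_units: "p > 0 \<Longrightarrow> \<one>\<^bsub>padic_ring p\<^esub> \<in> principal_units p k"
  using padic_of_int_carrier[of p 1]
  by (auto simp: principal_units_iff padic_ring_simps(4) padic_of_int_def)

section \<open>Cosets of integers modulo principal units\<close>

lemma principal_unit_class_eq:
  "principal_unit_class p r q m = {x \<otimes>\<^bsub>padic_ring p\<^esub> padic_of_int p m |x. x \<in> principal_units p (q + r)}"
  by (auto simp: principal_unit_class_def r_coset_def principal_unit_group_def)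

text \<open>Commutativity of Z_p collects the two principal units in front of m * n. For the reverse
  inclusion the second coset contributes the principal unit 1.\<close>

lemma principal_unit_class_mult:
  assumes "p > 0"
  shows "principal_unit_class p r q m \<otimes>\<^bsub>principal_unit_quotient p r q\<^esub> principal_unit_class p r q n =
    principal_unit_class p r q (m * n)"
proof -
  let ?R = "padic_ring p" and ?U = "principal_units p (q + r)"
  let ?i = "padic_of_int p"
  have eq: "(x \<otimes>\<^bsub>?R\<^esub> ?i m) \<otimes>\<^bsub>?R\<^esub> (y \<otimes>\<^bsub>?R\<^esub> ?i n) = (x \<otimes>\<^bsub>?R\<^esub> y) \<otimes>\<^bsub>?R\<^esub> ?i (m * n)" for x y
    by (metis padic_mult_assoc padic_mult_comm padic_of_int_mult)
  have "principal_unit_class p r q m \<otimes>\<^bsub>principal_unit_quotient p r q\<^esub> principal_unit_class p r q n =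
      {(x \<otimes>\<^bsub>?R\<^esub> ?i m) \<otimes>\<^bsub>?R\<^esub> (y \<otimes>\<^bsub>?R\<^esub> ?i n) |x y. x \<in> ?U \<and> y \<in> ?U}"
    by (auto simp: principal_unit_class_eq principal_unit_quotient_def FactGroup_def set_mult_def
        principal_unit_group_def)
  also have "\<dots> = principal_unit_class p r q (m * n)"
  proof (intro equalityI subsetI)
    fix z assume "z \<in> principal_unit_class p r q (m * n)"
    then obtain x where x: "x \<in> ?U" "z = x \<otimes>\<^bsub>?R\<^esub> ?i (m * n)"
      by (auto simp: principal_unit_class_eq)
    moreover have "x \<otimes>\<^bsub>?R\<^esub> \<one>\<^bsub>?R\<^esub> = x"
      using x assms by (metis padic_mult_comm padic_one_mult principal_units_iff)
    ultimately show "z \<in> {(x \<otimes>\<^bsub>?R\<^esub> ?i m) \<otimes>\<^bsub>?R\<^esub> (y \<otimes>\<^bsub>?R\<^esub> ?i n) |x y. x \<in> ?U \<and> y \<in> ?U}"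
      using one_in_principal_units[OF assms] unfolding eq by force
  qed (use assms in \<open>auto simp: eq principal_unit_class_eq intro!: principal_units_mult\<close>)
  finally show ?thesis .
qed

lemma principal_unit_class_carrier:
  assumes "p > 0" "[m = 1] (mod int p ^ r)"
  shows "principal_unit_class p r q m \<in> carrier (principal_unit_quotient p r q)"
proof -
  have "padic_of_int p m \<in> principal_units p r"
    using assms by (simp add: principal_units_iff padic_of_int_carrier) (simp add: padic_of_int_def)
  then show ?thesis
    by (auto simp: principal_unit_quotient_def FactGroup_def RCOSETS_def principal_unit_class_def
        principal_unit_group_def)
qed

lemma padic_of_int_in_class:
  assumes "p > 0"
  shows "padic_of_int p m \<in> principal_unit_class p r q m"
  using one_in_principal_units[OF assms] padic_one_mult[OF padic_of_int_carrier[OF assms]]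
  unfolding principal_unit_class_eq by (intro CollectI exI[of _ "\<one>\<^bsub>padic_ring p\<^esub>"]) simp

text \<open>The p-adic number m / n is a principal unit of level q + r, and it carries the coset of
  m into that of n.\<close>

lemma principal_unit_class_subset:
  assumes "prime p" "coprime n (int p)" "[m = n] (mod int p ^ (q + r))"
  shows "principal_unit_class p r q m \<subseteq> principal_unit_class p r q n"
proof -
  let ?R = "padic_ring p"
  have p: "p > 0" using assms(1) prime_gt_0_nat by blast
  \<comment> \<open>This is 1 / n in Z_p, entry by entry. Coherence holds because an inverse modulo
    p^k is unique modulo p^k.\<close>
  define w where "w = (\<lambda>k. modular_inverse (int p ^ k) n mod int p ^ k)"
  have inv: "[n * w k = 1] (mod int p ^ k)" for k
    using cong_modular_inverse1[of n "int p ^ k"] assms(2) by (simp add: w_def cong_def mod_simps)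
  have "w (Suc k) mod int p ^ k = w k" for k
  proof -
    have "[n * w (Suc k) = n * w k] (mod int p ^ k)"
      using inv[of "Suc k"] inv[of k] by (metis cong_dvd_modulus cong_sym cong_trans le_imp_power_dvd le_SucI order_refl)
    then have "[w (Suc k) = w k] (mod int p ^ k)"
      using assms(2) by (simp add: cong_mult_lcancel)
    then show ?thesis by (simp add: cong_def w_def)
  qed
  then have w: "w \<in> carrier ?R"
    using p by (auto simp add: padic_ring_simps) (simp_all add: w_def)
  define v where "v = padic_of_int p m \<otimes>\<^bsub>?R\<^esub> w"
  have "[m * w (q + r) = n * w (q + r)] (mod int p ^ (q + r))"
    using assms(3) by (rule cong_scalar_right)
  then have "[m * w (q + r) = 1] (mod int p ^ (q + r))"
    using inv cong_trans by blast
  then have "[v (q + r) = 1] (mod int p ^ (q + r))"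
    unfolding v_def by (simp add: padic_ring_simps padic_of_int_def cong_def mod_simps)
  then have v: "v \<in> principal_units p (q + r)"
    using p w by (simp add: principal_units_iff v_def padic_mult_closed padic_of_int_carrier)
  have "w \<otimes>\<^bsub>?R\<^esub> padic_of_int p n = \<one>\<^bsub>?R\<^esub>"
    using inv by (simp add: padic_ring_simps padic_of_int_def cong_def mod_simps mult.commute fun_eq_iff)
  then have eq: "v \<otimes>\<^bsub>?R\<^esub> padic_of_int p n = padic_of_int p m"
    unfolding v_def padic_mult_assoc
    using padic_one_mult[OF padic_of_int_carrier[OF p]] padic_mult_comm by metis
  show ?thesis
  proof
    fix x assume "x \<in> principal_unit_class p r q m"
    then obtain y where "y \<in> principal_units p (q + r)" "x = y \<otimes>\<^bsub>?R\<^esub> padic_of_int p m"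
      by (auto simp: principal_unit_class_eq)
    then show "x \<in> principal_unit_class p r q n"
      using v p unfolding principal_unit_class_eq
      by (auto simp: eq[symmetric] padic_mult_assoc[symmetric] intro!: principal_units_mult)
  qed
qed

text \<open>Forwards, compare entry q + r, where every principal unit of that level is 1. This is
  what turns faithfulness of \<chi> into a congruence of integers.\<close>

lemma principal_unit_class_eq_iff:
  assumes "prime p" "coprime m (int p)" "coprime n (int p)"
  shows "principal_unit_class p r q m = principal_unit_class p r q n \<longleftrightarrow> [m = n] (mod int p ^ (q + r))"
proof
  have p: "p > 0" using assms(1) prime_gt_0_nat by blast
  assume "principal_unit_class p r q m = principal_unit_class p r q n"
  then obtain x where x: "x \<in> principal_units p (q + r)"
    "padic_of_int p m = x \<otimes>\<^bsub>padic_ring p\<^esub> padic_of_int p n"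
    using padic_of_int_in_class[OF p, of m r q] by (auto simp: principal_unit_class_eq)
  from fun_cong[OF x(2), of "q + r"]
  have "[m = x (q + r) * n] (mod int p ^ (q + r))"
    by (simp add: padic_ring_simps padic_of_int_def cong_def mod_simps)
  also have "[x (q + r) * n = 1 * n] (mod int p ^ (q + r))"
    using x(1) p by (intro cong_scalar_right) (simp add: principal_units_iff)
  finally show "[m = n] (mod int p ^ (q + r))" by simp
next
  assume "[m = n] (mod int p ^ (q + r))"
  then show "principal_unit_class p r q m = principal_unit_class p r q n"
    using assms principal_unit_class_subset cong_sym by (metis subset_antisym)
qed

subsection \<open>The monomial group of a deformed bicharacter\<close>

text \<open>Reduces a congruence to a polynomial identity: the multipliers \<open>k\<close> and
  \<open>j\<close> are a certificate that \<open>algebra_simps\<close> can check.\<close>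

lemma cong_lincomb:
  fixes m :: int
  assumes "[a = b] (mod m)" "[c = d] (mod m)" "x - y = k * (a - b) + j * (c - d)"
  shows "[x = y] (mod m)"
  using assms by (simp add: cong_iff_dvd_diff)

text \<open>\<open>h_mult\<close> transports the multiplication of the numbers 1 + p^r x to their
  parameters x. The bound r \<le> q makes reduction from modulus p^q to modulus p^r well defined.
  That \<open>h\<close> has unimodular values is derived in \<open>norm_h\<close>.\<close>

locale deformed_bicharacter =
  fixes p r q :: nat and h :: "int \<Rightarrow> complex"
  assumes prime_p: "prime p" and odd_p: "odd p" and r_pos: "1 \<le> r" and r_le_q: "r \<le> q"
    and h_mult: "h x * h y = h (x + y + int p ^ r * x * y)"
    and h_eq_iff: "h x = h y \<longleftrightarrow> [x = y] (mod int p ^ q)"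
begin

abbreviation N :: int where "N \<equiv> int p ^ q"
abbreviation P :: int where "P \<equiv> int p ^ r"
abbreviation I :: "int set" where "I \<equiv> res_set p q"
abbreviation H :: "int \<Rightarrow> int \<Rightarrow> complex" where "H \<equiv> (\<lambda>a b. h (a * b))"
abbreviation A :: "int quad monoid" where "A \<equiv> monomial_group I H"
abbreviation G :: "int quad set monoid" where "G \<equiv> projective_monomial_group I H"

text \<open>The representative whose scalar functions are 1 at index 0. The parameters are arbitrary
  integers, so that products can be written without reduction modulo p^q.\<close>

definition quad :: "int \<Rightarrow> int \<Rightarrow> int \<Rightarrow> int quad" where
  "quad c s l = (mobius_perm p r q s c l, mobius_perm p r q c s l, \<lambda>a\<in>I. h (a * s), \<lambda>b\<in>I. h (c * b))"

definition elt :: "int \<Rightarrow> int \<Rightarrow> int \<Rightarrow> int quad set" where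
  "elt c s l = monomial_scalars I #>\<^bsub>A\<^esub> quad c s l"

lemma p_gt_1: "p > 1" and p_prime_int: "prime (int p)"
  using prime_p prime_gt_1_nat by auto

lemma q_pos: "q \<ge> 1"
  using r_pos r_le_q by simp

lemma N_gt_1: "N > 1" and P_gt_1: "P > 1"
  using p_gt_1 q_pos r_pos by (auto intro!: one_less_power)

lemma I_eq: "I = {0..<N}"
  by (auto simp: residue_ring_def)

lemma I_simps [simp]: "0 \<in> I" "1 \<in> I" "x mod N \<in> I" "finite I"
  using N_gt_1 p_gt_1 pos_mod_bound[of N x] pos_mod_sign[of N x] by (auto simp: I_eq)

lemma I_cong_eq: "x \<in> I \<Longrightarrow> y \<in> I \<Longrightarrow> [x = y] (mod N) \<Longrightarrow> x = y"
  by (simp add: I_eq cong_def)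

lemma p_dvd_P: "int p dvd P" and P_dvd_N: "P dvd N" and p_dvd_N: "int p dvd N"
  using r_pos q_pos r_le_q by (auto intro: le_imp_power_dvd)

lemma coprime_N_iff: "coprime x N \<longleftrightarrow> coprime x (int p)"
  using q_pos by simp

lemma coprime_P_iff: "coprime x P \<longleftrightarrow> coprime x (int p)"
  using r_pos by simp

text \<open>As r \<ge> 1, such a number is 1 modulo p; hence all denominators that occur are
  invertible modulo p^q.\<close>

lemma coprime_1_plus: "coprime (1 + P * x) (int p)"
proof -
  have "[1 = 1 + P * x] (mod int p)"
    using p_dvd_P by (simp add: cong_iff_dvd_diff)
  then show ?thesis
    by (rule cong_imp_coprime) simp
qed

section \<open>Moebius permutations\<close>

lemma mobius_in [simp]: "b \<in> I \<Longrightarrow> mobius_perm p r q u t l b \<in> I"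
  by (simp add: mobius_perm_def)

text \<open>Clears the denominator, so that later arguments work with polynomial congruences instead
  of \<open>modular_inverse\<close>.\<close>

lemma mobius_eq_iff:
  assumes "b \<in> I" "y \<in> I"
  shows "mobius_perm p r q u t l b = y \<longleftrightarrow> [y * (1 + P * u * b) = t + l * b] (mod N)"
proof -
  define U where "U = 1 + P * u * b"
  define m where "m = modular_inverse N U"
  have m: "[U * m = 1] (mod N)"
    unfolding m_def using coprime_1_plus[of "u * b"]
    by (intro cong_modular_inverse1) (simp add: U_def coprime_N_iff mult.assoc del: coprime_power_right_iff)
  have "mobius_perm p r q u t l b = y \<longleftrightarrow> [(t + l * b) * m = y] (mod N)"
    using assms by (auto simp: mobius_perm_def m_def U_def cong_def I_eq)
  also have "\<dots> \<longleftrightarrow> [y * U = t + l * b] (mod N)"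
  proof
    assume "[(t + l * b) * m = y] (mod N)"
    then show "[y * U = t + l * b] (mod N)"
      by (rule cong_lincomb[OF _ m, where k = "-U" and j = "t + l * b"]) (simp add: algebra_simps)
  next
    assume "[y * U = t + l * b] (mod N)"
    then show "[(t + l * b) * m = y] (mod N)"
      by (rule cong_lincomb[OF _ m, where k = "-m" and j = y]) (simp add: algebra_simps)
  qed
  finally show ?thesis by (simp add: U_def)
qed

text \<open>The integer \<open>b'\<close> need not be reduced: in a composition, the inner value can
  be replaced by any convenient representative.\<close>

lemma mobius_cong:
  assumes "b \<in> I" "[b = b'] (mod N)"
  shows "[mobius_perm p r q u t l b * (1 + P * u * b') = t + l * b'] (mod N)"
proof -
  have "[mobius_perm p r q u t l b * (1 + P * u * b) = t + l * b] (mod N)"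
    using mobius_eq_iff[OF assms(1) mobius_in[OF assms(1)]] by blast
  then show ?thesis
    by (rule cong_lincomb[OF _ assms(2), where k = 1 and
        j = "l - mobius_perm p r q u t l b * P * u"]) (simp add: algebra_simps)
qed

text \<open>Two preimages of y agree after multiplication by l - p^r u y, which is l modulo p and
  therefore a unit.\<close>

lemma mobius_permutes:
  assumes "coprime l (int p)"
  shows "mobius_perm p r q u t l permutes I"
proof (rule inj_imp_permutes)
  show "inj_on (mobius_perm p r q u t l) I"
  proof (rule inj_onI)
    fix b b' assume b: "b \<in> I" "b' \<in> I" and eq: "mobius_perm p r q u t l b = mobius_perm p r q u t l b'"
    define y where "y = mobius_perm p r q u t l b"
    have "[y * (1 + P * u * b) = t + l * b] (mod N)" "[y * (1 + P * u * b') = t + l * b'] (mod N)"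
      using mobius_cong[OF b(1) cong_refl, of u t l] mobius_cong[OF b(2) cong_refl, of u t l]
      by (simp_all add: y_def eq)
    then have "[(l - P * (u * y)) * b = (l - P * (u * y)) * b'] (mod N)"
      by (rule cong_lincomb[where k = "-1" and j = 1]) (simp add: algebra_simps)
    moreover have "coprime (l - P * (u * y)) (int p)"
    proof -
      have "[l = l - P * (u * y)] (mod int p)"
        using p_dvd_P by (simp add: cong_iff_dvd_diff)
      then show ?thesis using assms by (rule cong_imp_coprime)
    qed
    ultimately show "b = b'"
      using b by (simp add: cong_mult_lcancel I_cong_eq)
  qed
qed (auto simp: mobius_perm_def)

lemma mobius_mod_cong:
  assumes "[u = u'] (mod N)" "[t = t'] (mod N)" "[l = l'] (mod N)"
  shows "mobius_perm p r q u t l = mobius_perm p r q u' t' l'"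
proof
  fix b
  show "mobius_perm p r q u t l b = mobius_perm p r q u' t' l' b"
  proof (cases "b \<in> I")
    case True
    let ?y = "mobius_perm p r q u' t' l' b"
    have "[?y * (1 + P * u * b) = ?y * (1 + P * u' * b)] (mod N)"
      using assms by (intro cong_mult cong_add cong_refl)
    also have "[?y * (1 + P * u' * b) = t' + l' * b] (mod N)"
      using True by (intro mobius_cong cong_refl)
    also have "[t' + l' * b = t + l * b] (mod N)"
      using assms by (intro cong_mult cong_add cong_refl) (auto intro: cong_sym)
    finally show ?thesis
      using True by (simp add: mobius_eq_iff)
  qed (simp add: mobius_perm_def)
qed

section \<open>Values of \<open>h\<close>\<close>

lemma h_0: "h 0 = 1" and h_nz: "h x \<noteq> 0"
proof -
  \<comment> \<open>If \<open>h 0\<close> vanished, so would \<open>h 1 = h 0 * h 1\<close>, against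
    injectivity modulo p^q.\<close>
  have "h 0 \<noteq> 0"
  proof
    assume "h 0 = 0"
    then have "h 1 = 0" using h_mult[of 0 1] by simp
    with \<open>h 0 = 0\<close> have "[0 = 1] (mod N)" using h_eq_iff by metis
    then show False using N_gt_1 by (simp add: cong_def)
  qed
  moreover have "h 0 * h 0 = h 0" using h_mult[of 0 0] by simp
  ultimately show "h 0 = 1" by simp
  show "h x \<noteq> 0"
  proof
    \<comment> \<open>A zero absorbs multiplication by \<open>h 1\<close>, so injectivity would make
      p divide 1 + p^r x.\<close>
    assume *: "h x = 0"
    have "h (x + 1 + P * x * 1) = h x" using h_mult[of x 1] * by simp
    then have "[1 + P * x = 0] (mod N)"
      by (simp add: h_eq_iff cong_iff_dvd_diff algebra_simps)
    then have "int p dvd 1 + P * x"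
      using p_dvd_N by (simp add: cong_0_iff dvd_trans del: dvd_power_iff)
    from coprime_common_divisor[OF coprime_1_plus this dvd_refl] show False
      using p_gt_1 by simp
  qed
qed

text \<open>The powers of \<open>h x\<close> stay in the range of \<open>h\<close>, which is finite
  by periodicity. So two different powers of \<open>cmod (h x)\<close> coincide, and a positive real
  with this property is 1.\<close>

lemma norm_h: "cmod (h x) = 1"
proof -
  have "\<exists>y. h x ^ n = h y \<and> 1 + P * y = (1 + P * x) ^ n" for n
  proof (induction n)
    case 0
    then show ?case by (intro exI[of _ 0]) (simp add: h_0)
  next
    case (Suc n)
    then obtain y where y: "h x ^ n = h y" "1 + P * y = (1 + P * x) ^ n" by auto
    have "(1 + P * x) ^ Suc n = (1 + P * x) * (1 + P * y)" by (simp add: y)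
    then show ?case
      using y by (intro exI[of _ "x + y + P * x * y"]) (simp add: h_mult algebra_simps)
  qed
  moreover have "finite (range h)"
  proof (rule finite_subset)
    show "range h \<subseteq> h ` I"
    proof safe
      fix x show "h x \<in> h ` I"
        by (rule image_eqI[of _ _ "x mod N"]) (simp_all add: h_eq_iff)
    qed
  qed simp
  ultimately have "finite (range (\<lambda>n. h x ^ n))"
    by (metis (mono_tags, lifting) finite_subset image_subsetI rangeI)
  then have "finite ((\<lambda>z. cmod z) ` range (\<lambda>n. h x ^ n))" by simp
  then have "finite (range (\<lambda>n. cmod (h x) ^ n))"
    by (simp add: image_image norm_power)
  then have "\<not> inj (\<lambda>n. cmod (h x) ^ n)"
    using finite_imageD by blast
  then obtain m n where mn: "cmod (h x) ^ m = cmod (h x) ^ n" "m \<noteq> n"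
    by (auto simp: inj_on_def)
  show ?thesis
    using mn h_nz[of x] power_inject_exp'[of "cmod (h x)" m n] by auto
qed


text \<open>With denominators cleared, both sides of the defining equation become
  \<open>h (a * s + c * b + l * a * b)\<close>.\<close>

lemma quad_carrier:
  assumes "coprime l (int p)"
  shows "quad c s l \<in> carrier A"
proof -
  have "h (a * mobius_perm p r q c s l b) * h (c * b) = h (a * s) * h (mobius_perm p r q s c l a * b)"
    if a: "a \<in> I" and b: "b \<in> I" for a b
  proof -
    let ?x = "mobius_perm p r q c s l b" and ?y = "mobius_perm p r q s c l a"
    have "[?x * (1 + P * c * b) = s + l * b] (mod N)" "[?y * (1 + P * s * a) = c + l * a] (mod N)"
      using a b by (auto intro: mobius_cong)
    then show ?thesis
      unfolding h_mult h_eq_iff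
      by (rule cong_lincomb[where k = a and j = "-b"]) (simp add: algebra_simps)
  qed
  then show ?thesis
    using assms by (auto simp: monomial_group_def quad_def norm_h mobius_permutes)
qed

section \<open>Coordinates and products in the projective group\<close>

lemma scalars_normal: "monomial_scalars I \<lhd> A"
  by (rule normal_monomial_scalars)

lemma group_A: "group A" and group_G: "group G"
  by (rule group_monomial_group) (rule group_projective_monomial_group)

text \<open>Comparing the defining equation at \<open>a = 0\<close>, \<open>b = 0\<close>, \<open>a = 1\<close> and \<open>b = 1\<close> determines the quadruple.\<close>

lemma coset_eq_elt:
  assumes X: "(\<pi>, \<sigma>, \<alpha>, \<omega>) \<in> carrier A"
  defines "c \<equiv> \<pi> 0" and "s \<equiv> \<sigma> 0"
  defines "l \<equiv> \<pi> 1 * (1 + P * s) - c"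
  shows "coprime l (int p)" and "monomial_scalars I #>\<^bsub>A\<^esub> (\<pi>, \<sigma>, \<alpha>, \<omega>) = elt c s l"
proof -
  have perm: "\<pi> permutes I" "\<sigma> permutes I"
    and ext: "\<alpha> \<in> I \<rightarrow>\<^sub>E {z. cmod z = 1}" "\<omega> \<in> I \<rightarrow>\<^sub>E {z. cmod z = 1}"
    and E: "\<And>a b. a \<in> I \<Longrightarrow> b \<in> I \<Longrightarrow> h (a * \<sigma> b) * \<omega> b = \<alpha> a * h (\<pi> a * b)"
    using X by (auto simp: monomial_group_def)
  have norm: "cmod (\<alpha> 0) = 1" and nz: "\<alpha> 0 \<noteq> 0"
    using ext PiE_mem[OF ext(1), of 0] by auto
  have \<omega>: "\<omega> b = \<alpha> 0 * h (c * b)" if "b \<in> I" for b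
    using E[of 0 b] that by (simp add: h_0 c_def)
  have \<alpha>: "\<alpha> a = \<alpha> 0 * h (a * s)" if "a \<in> I" for a
    using E[of a 0] \<omega>[of 0] that by (simp add: h_0 s_def mult.commute)
  have K: "[a * \<sigma> b + c * b + P * (a * \<sigma> b) * (c * b) = a * s + \<pi> a * b + P * (a * s) * (\<pi> a * b)] (mod N)"
    if "a \<in> I" "b \<in> I" for a b
    using E[OF that] nz unfolding \<omega>[OF that(2)] \<alpha>[OF that(1)] by (simp add: h_mult flip: h_eq_iff)
  have \<sigma>: "[\<sigma> b * (1 + P * c * b) = s + l * b] (mod N)" if "b \<in> I" for b
    by (rule cong_lincomb[OF K[of 1 b] cong_refl, where k = 1 and j = 0])
      (use that in \<open>simp_all add: l_def algebra_simps\<close>)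
  have \<pi>: "[\<pi> a * (1 + P * s * a) = c + l * a] (mod N)" if "a \<in> I" for a
    by (rule cong_lincomb[OF K[of a 1] \<sigma>[of 1], where k = "-1" and j = a])
      (use that in \<open>simp_all add: algebra_simps\<close>)
  \<comment> \<open>If p divided l, the formula for \<sigma> would make it constant modulo p, which
    contradicts surjectivity onto the residues 0 and 1.\<close>
  show cop: "coprime l (int p)"
  proof (rule ccontr)
    assume "\<not> coprime l (int p)"
    then have l: "int p dvd l"
      using p_prime_int prime_imp_coprime coprime_commute by blast
    have *: "[\<sigma> b = s] (mod int p)" if "b \<in> I" for b
    proof -
      have "[\<sigma> b * (1 + P * c * b) = s + l * b] (mod int p)"
        using \<sigma>[OF that] p_dvd_N cong_dvd_modulus by blast
      moreover have "[\<sigma> b * P * c * b - l * b = 0] (mod int p)"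
        using p_dvd_P l by (simp add: cong_0_iff)
      ultimately show ?thesis
        by (rule cong_lincomb[where k = 1 and j = "-1"]) (simp add: algebra_simps)
    qed
    have "[x = s] (mod int p)" if "x \<in> I" for x
    proof -
      have "x \<in> \<sigma> ` I"
        using that unfolding permutes_image[OF perm(2)] .
      then obtain b where b: "b \<in> I" "x = \<sigma> b" by (rule imageE) simp
      show ?thesis using *[OF b(1)] b(2) by simp
    qed
    from cong_trans[OF this[of 0] cong_sym[OF this[of 1]]] have "[0 = 1] (mod int p)"
      by simp
    then show False
      using p_gt_1 by (simp add: cong_def)
  qed
  have perm_eq: "\<sigma> = mobius_perm p r q c s l" "\<pi> = mobius_perm p r q s c l"
  proof -
    have "\<sigma> b = mobius_perm p r q c s l b" for b
      using \<sigma>[of b] perm(2) mobius_eq_iff[of b "\<sigma> b" c s l]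
      by (cases "b \<in> I") (auto simp: permutes_in_image permutes_not_in mobius_perm_def)
    moreover have "\<pi> b = mobius_perm p r q s c l b" for b
      using \<pi>[of b] perm(1) mobius_eq_iff[of b "\<pi> b" s c l]
      by (cases "b \<in> I") (auto simp: permutes_in_image permutes_not_in mobius_perm_def)
    ultimately show "\<sigma> = mobius_perm p r q c s l" "\<pi> = mobius_perm p r q s c l" by auto
  qed
  \<comment> \<open>The scalar by which the given quadruple differs from the normalised
    \<open>quad c s l\<close>.\<close>
  define z :: "int quad" where "z = (id, id, \<lambda>a\<in>I. \<alpha> 0, \<lambda>b\<in>I. \<alpha> 0)"
  have "restrict \<alpha> I = (\<lambda>a\<in>I. h (a * s) * \<alpha> 0)" "restrict \<omega> I = (\<lambda>b\<in>I. \<alpha> 0 * h (c * b))"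
    by (rule restrict_ext, subst \<alpha>, simp_all) (rule restrict_ext, rule \<omega>)
  then have \<alpha>\<omega>_eq: "\<alpha> = (\<lambda>a\<in>I. h (a * s) * \<alpha> 0)" "\<omega> = (\<lambda>b\<in>I. \<alpha> 0 * h (c * b))"
    unfolding PiE_restrict[OF ext(1)] PiE_restrict[OF ext(2)] .
  have "z \<otimes>\<^bsub>A\<^esub> quad c s l = (mobius_perm p r q s c l, mobius_perm p r q c s l,
      \<lambda>a\<in>I. h (a * s) * \<alpha> 0, \<lambda>b\<in>I. \<alpha> 0 * h (c * b))"
    by (auto simp: z_def monomial_group_def quad_def intro!: restrict_ext)
  then have "(\<pi>, \<sigma>, \<alpha>, \<omega>) = z \<otimes>\<^bsub>A\<^esub> quad c s l"
    unfolding prod.inject using perm_eq \<alpha>\<omega>_eq by metis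
  moreover have "z \<in> monomial_scalars I"
    using norm by (auto simp: monomial_scalars_def z_def)
  ultimately have "(\<pi>, \<sigma>, \<alpha>, \<omega>) \<in> elt c s l"
    by (auto simp: elt_def r_coset_def)
  then show "monomial_scalars I #>\<^bsub>A\<^esub> (\<pi>, \<sigma>, \<alpha>, \<omega>) = elt c s l"
    unfolding elt_def
    using group.repr_independence[OF group_A] quad_carrier[OF cop] scalars_normal normal_imp_subgroup by metis
qed

lemma carrier_G: "carrier G = {elt c s l |c s l. coprime l (int p)}"
proof (intro equalityI subsetI)
  fix X assume "X \<in> carrier G"
  then obtain x where "x \<in> carrier A" "X = monomial_scalars I #>\<^bsub>A\<^esub> x"
    by (auto simp: projective_monomial_group_def FactGroup_def RCOSETS_def)
  moreover obtain \<pi> \<sigma> \<alpha> \<omega> where "x = (\<pi>, \<sigma>, \<alpha>, \<omega>)" by (metis prod_cases4)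
  ultimately show "X \<in> {elt c s l |c s l. coprime l (int p)}"
    using coset_eq_elt[of \<pi> \<sigma> \<alpha> \<omega>] by blast
qed (auto simp: projective_monomial_group_def FactGroup_def RCOSETS_def elt_def dest: quad_carrier)

lemma elt_closed: "coprime l (int p) \<Longrightarrow> elt c s l \<in> carrier G"
  by (auto simp: carrier_G)

lemma elt_cong:
  assumes "[c = c'] (mod N)" "[s = s'] (mod N)" "[l = l'] (mod N)"
  shows "elt c s l = elt c' s' l'"
proof -
  have "h (a * s) = h (a * s')" "h (c * b) = h (c' * b)" for a b
    using assms by (auto simp: h_eq_iff intro: cong_mult)
  then have "quad c s l = quad c' s' l'"
    using assms mobius_mod_cong by (auto simp: quad_def intro!: restrict_ext)
  then show ?thesis by (simp add: elt_def)
qed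

text \<open>Scalars leave the permutations of a quadruple unchanged, so equal cosets have equal
  permutations. Their values at 0 give c and s; the row permutation at 1 then gives l.\<close>

lemma elt_eq_iff:
  assumes "coprime l (int p)" "coprime l' (int p)"
  shows "elt c s l = elt c' s' l' \<longleftrightarrow> [c = c'] (mod N) \<and> [s = s'] (mod N) \<and> [l = l'] (mod N)"
proof
  assume "elt c s l = elt c' s' l'"
  then have "quad c s l \<in> monomial_scalars I #>\<^bsub>A\<^esub> quad c' s' l'"
    unfolding elt_def
    using group.rcos_self[OF group_A quad_carrier[OF assms(1)] normal_imp_subgroup[OF scalars_normal]] by metis
  then have eq: "mobius_perm p r q s c l = mobius_perm p r q s' c' l'"
      "mobius_perm p r q c s l = mobius_perm p r q c' s' l'"
    by (auto simp: r_coset_def monomial_scalars_def quad_def monomial_group_def)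
  have 0: "[c = c'] (mod N)" "[s = s'] (mod N)"
    using mobius_cong[of 0 0 s c l] mobius_cong[of 0 0 s' c' l']
      mobius_cong[of 0 0 c s l] mobius_cong[of 0 0 c' s' l']
    by (simp_all add: eq) (metis cong_sym cong_trans)+
  let ?y = "mobius_perm p r q s' c' l' 1"
  have "[?y * (1 + P * s) = c + l] (mod N)" "[?y * (1 + P * s') = c' + l'] (mod N)"
    using mobius_cong[of 1 1 s c l] mobius_cong[of 1 1 s' c' l'] by (simp_all add: eq)
  then have "[c + l - ?y * P * s = c' + l' - ?y * P * s'] (mod N)"
    by (rule cong_lincomb[where k = "-1" and j = 1]) (simp add: algebra_simps)
  moreover have "[c - ?y * P * s = c' - ?y * P * s'] (mod N)"
    using 0 by (intro cong_diff cong_mult cong_refl)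
  ultimately have "[l = l'] (mod N)"
    by (rule cong_lincomb[where k = 1 and j = "-1"]) (simp add: algebra_simps)
  with 0 show "[c = c'] (mod N) \<and> [s = s'] (mod N) \<and> [l = l'] (mod N)" by simp
qed (elim conjE, rule elt_cong)

text \<open>The hypotheses are the product formula multiplied through by the unit u, so concrete
  products can be verified without computing inverses.\<close>

lemma elt_mult:
  fixes c s l c' s' l' c'' s'' l'' :: int
  assumes cop: "coprime l (int p)" "coprime l' (int p)"
  defines "u \<equiv> 1 + P * (s * c')"
  assumes c: "[u * c'' = c + l * c'] (mod N)"
    and s: "[u * s'' = l' * s + s'] (mod N)"
    and l: "[u * l'' = l * l' + P * c * s'] (mod N)"
  shows "elt c s l \<otimes>\<^bsub>G\<^esub> elt c' s' l' = elt c'' s'' l''"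
proof -
  let ?\<pi> = "mobius_perm p r q s c l" and ?\<sigma> = "mobius_perm p r q c s l"
  let ?\<pi>' = "mobius_perm p r q s' c' l'" and ?\<sigma>' = "mobius_perm p r q c' s' l'"
  define c1 where "c1 = ?\<pi> (?\<pi>' 0)"
  define s1 where "s1 = ?\<sigma>' (?\<sigma> 0)"
  define t where "t = ?\<pi> (?\<pi>' 1)"
  interpret group A by (rule group_A)
  have "elt c s l \<otimes>\<^bsub>G\<^esub> elt c' s' l' = monomial_scalars I #>\<^bsub>A\<^esub> (quad c s l \<otimes>\<^bsub>A\<^esub> quad c' s' l')"
    using normal.rcos_sum[OF scalars_normal quad_carrier[OF cop(1)] quad_carrier[OF cop(2)]]
    by (simp add: elt_def projective_monomial_group_def FactGroup_def)
  also have "\<dots> = elt c1 s1 (t * (1 + P * s1) - c1)"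
  proof -
    \<comment> \<open>The scalar functions stay anonymous: \<open>coset_eq_elt\<close> reads the
      coordinates off the composed permutations at 0 and 1.\<close>
    obtain \<alpha> \<omega> where eq: "quad c s l \<otimes>\<^bsub>A\<^esub> quad c' s' l' = (?\<pi> \<circ> ?\<pi>', ?\<sigma>' \<circ> ?\<sigma>, \<alpha>, \<omega>)"
      by (simp add: monomial_group_def quad_def)
    have "quad c s l \<otimes>\<^bsub>A\<^esub> quad c' s' l' \<in> carrier A"
      using cop by (simp add: quad_carrier)
    from coset_eq_elt(2)[OF this[unfolded eq]] show ?thesis
      by (simp add: eq c1_def s1_def t_def)
  qed
  also have "\<dots> = elt c'' s'' l''"
  proof (rule elt_cong)
    have u: "coprime u N"
      unfolding u_def coprime_N_iff by (rule coprime_1_plus)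
    have y0: "[?\<pi>' 0 = c'] (mod N)" "[?\<sigma> 0 = s] (mod N)"
      using mobius_cong[of 0 0 s' c' l'] mobius_cong[of 0 0 c s l] by simp_all
    have c1: "[u * c1 = c + l * c'] (mod N)"
      by (rule cong_lincomb[OF mobius_cong[OF _ y0(1), of s c l] cong_refl, where k = 1 and j = 0])
        (simp_all add: c1_def u_def algebra_simps)
    have s1: "[u * s1 = l' * s + s'] (mod N)"
      by (rule cong_lincomb[OF mobius_cong[OF _ y0(2), of c' s' l'] cong_refl, where k = 1 and j = 0])
        (simp_all add: s1_def u_def algebra_simps)
    show "[c1 = c''] (mod N)" "[s1 = s''] (mod N)"
      using cong_trans[OF c1 cong_sym[OF c]] cong_trans[OF s1 cong_sym[OF s]] u
      by (simp_all add: cong_mult_lcancel)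
    define y where "y = ?\<pi>' 1"
    have y: "[y * (1 + P * s') = c' + l'] (mod N)"
      using mobius_cong[of 1 1 s' c' l'] by (simp add: y_def)
    have "[t * (1 + P * s * y) = c + l * y] (mod N)"
      by (simp add: y_def t_def mobius_cong)
    \<comment> \<open>Multiplication by 1 + p^r s' removes the denominator of the inner value
      y.\<close>
    then have "[t * (1 + P * s' + P * s * (c' + l')) = c * (1 + P * s') + l * (c' + l')] (mod N)"
      by (rule cong_lincomb[OF _ y, where k = "1 + P * s'" and j = "l - t * P * s"])
        (simp add: algebra_simps)
    moreover have "[t * P * (u * s1) - u * c1 = t * P * (l' * s + s') - (c + l * c')] (mod N)"
      using c1 s1 by (intro cong_diff cong_mult cong_refl)
    ultimately have "[u * (t * (1 + P * s1) - c1) = l * l' + P * c * s'] (mod N)"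
      by (rule cong_lincomb[where k = 1 and j = 1]) (simp add: u_def algebra_simps)
    with l have "[u * (t * (1 + P * s1) - c1) = u * l''] (mod N)"
      using cong_sym cong_trans by blast
    then show "[t * (1 + P * s1) - c1 = l''] (mod N)"
      using u by (simp add: cong_mult_lcancel)
  qed
  finally show ?thesis .
qed

end

subsection \<open>Abelianization\<close>

text \<open>Each p-th power gains one factor p: in x^p - 1 = (x - 1)(1 + x + ... + x^(p-1)) the
  second factor is a sum of p terms, all 1 modulo p.\<close>

lemma power_cong_1_raise:
  fixes w :: int
  assumes "[w = 1] (mod int p ^ r)" "r \<ge> 1"
  shows "[w ^ (p ^ k) = 1] (mod int p ^ (r + k))"
proof (induction k)
  case 0
  then show ?case using assms by simp
next
  case (Suc k)
  define x where "x = w ^ (p ^ k)"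
  have x: "[x = 1] (mod int p ^ (r + k))" using Suc by (simp add: x_def)
  then have "[x = 1] (mod int p)"
    by (rule cong_dvd_modulus) (use assms in simp)
  then have "[(\<Sum>i<p. x ^ i) = (\<Sum>i<p. 1 ^ i)] (mod int p)"
    by (intro cong_sum cong_pow)
  then have "int p dvd (\<Sum>i<p. x ^ i)"
    by (simp add: cong_dvd_iff)
  moreover have "int p ^ (r + k) dvd x - 1"
    using x by (simp add: cong_iff_dvd_diff)
  ultimately have "int p ^ (r + k) * int p dvd (x - 1) * (\<Sum>i<p. x ^ i)"
    by (rule mult_dvd_mono[rotated])
  also have "(x - 1) * (\<Sum>i<p. x ^ i) = x ^ p - 1"
    by (simp add: power_diff_1_eq)
  finally show ?case
    by (simp add: cong_iff_dvd_diff x_def mult.commute flip: power_mult)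
qed

text \<open>The equation y = g x g^-1 x^-1 with its inverses cleared, so that only products have to
  be evaluated.\<close>

lemma (in group) commutatorI:
  assumes "x \<in> carrier G" "g \<in> carrier G" "y \<in> carrier G" "y \<otimes> (x \<otimes> g) = g \<otimes> x"
  shows "y \<in> derived G (carrier G)"
proof -
  have "y = g \<otimes> x \<otimes> inv g \<otimes> inv x"
    using assms by (metis inv_closed inv_mult_group inv_solve_right m_assoc m_closed)
  then show ?thesis
    using assms unfolding derived_def by (blast intro: generate.incl)
qed

text \<open>A homomorphism maps the derived subgroup onto that of its image, which is trivial in a
  commutative group.\<close>

lemma (in group_hom) derived_subset_kernel:
  assumes "comm_group H"
  shows "derived G (carrier G) \<subseteq> kernel G H h"
proof
  fix x assume x: "x \<in> derived G (carrier G)"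
  have "h ` derived G (carrier G) = {\<one>\<^bsub>H\<^esub>}"
    using derived_img[of "carrier G"] comm_group.derived_eq_singleton[OF assms, of "h ` carrier G"]
    by (simp add: image_subset_iff)
  then show "x \<in> kernel G H h"
    using x G.derived_in_carrier[of "carrier G"] unfolding kernel_def by blast
qed

text \<open>An isomorphism preserves the orders of the group and of its derived subgroup; by
  Lagrange the order of the abelianization is their quotient.\<close>

lemma order_abelianization_iso:
  assumes "group G" "group H" "G \<cong> H" "finite (carrier G)"
  shows "order (abelianization G) = order (abelianization H)"
proof -
  obtain f where f: "f \<in> iso G H" using assms(3) by (auto simp: is_iso_def)
  interpret group_hom G H f
    using assms f by (simp add: group_hom_def group_hom_axioms_def iso_def)
  have bij: "bij_betw f (carrier G) (carrier H)" using f by (simp add: iso_def)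
  have "f ` derived G (carrier G) = derived H (carrier H)"
    using derived_img[of "carrier G"] bij by (simp add: bij_betw_def)
  then have card: "card (derived G (carrier G)) = card (derived H (carrier H))"
    using bij G.derived_in_carrier[of "carrier G"] by (metis bij_betw_def card_image inj_on_subset order_refl)
  have fin: "finite (carrier H)" using bij assms(4) bij_betw_finite by blast
  have "card (rcosets\<^bsub>G\<^esub> derived G (carrier G)) * card (derived G (carrier G)) = order G"
    "card (rcosets\<^bsub>H\<^esub> derived H (carrier H)) * card (derived H (carrier H)) = order H"
    using G.lagrange_finite[OF assms(4)] H.lagrange_finite[OF fin]
      G.derived_is_subgroup H.derived_is_subgroup by auto
  moreover have "order G = order H" using iso_same_card[OF assms(3)] by (simp add: order_def)
  moreover have "card (derived G (carrier G)) > 0"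
    using finite_subset[OF G.derived_in_carrier assms(4)] subgroup.one_closed[OF G.derived_is_subgroup]
    by (metis card_gt_0_iff empty_iff order_refl)
  ultimately have "card (rcosets\<^bsub>G\<^esub> derived G (carrier G)) = card (rcosets\<^bsub>H\<^esub> derived H (carrier H))"
    by (metis card mult_right_cancel less_numeral_extra(3))
  then show ?thesis by (simp add: order_def abelianization_def FactGroup_def)
qed

lemma units_residue_ring: "m > 1 \<Longrightarrow> Units (residue_ring m) = {x. 0 < x \<and> x < m \<and> coprime x m}"
  using residues.res_units_eq[OF residues.intro] by simp

context deformed_bicharacter
begin

text \<open>The counterpart of \<open>phi\<close> for a general \<open>h\<close>, so that it also
  serves the Fourier matrix; \<open>phi_eq\<close> identifies the two for
  \<open>H_matrix\<close>.\<close>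

definition phi_h :: "int quad set \<Rightarrow> int" where
  "phi_h X = (case the_inv_into (I \<times> I \<times> res_units p q) (\<lambda>(c, s, l). elt c s l) X of (c, s, l) \<Rightarrow> l mod P)"

abbreviation U :: "int monoid" where "U \<equiv> units_of (residue_ring P)"

text \<open>The coordinates are residues modulo p^q, and reducing first modulo p^q is harmless
  because p^r divides p^q.\<close>

lemma phi_h_elt:
  assumes "coprime l (int p)"
  shows "phi_h (elt c s l) = l mod P"
proof -
  let ?D = "I \<times> I \<times> res_units p q"
  have U: "res_units p q = {x \<in> I. coprime x (int p)}"
    using N_gt_1 p_gt_1 by (auto simp: units_residue_ring I_eq coprime_N_iff simp del: coprime_power_right_iff intro: le_neq_trans)
  have inj: "inj_on (\<lambda>(c, s, l). elt c s l) ?D"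
    by (auto simp: inj_on_def U elt_eq_iff intro: I_cong_eq)
  have mem: "(c mod N, s mod N, l mod N) \<in> ?D"
    using assms cong_imp_coprime[of l "l mod N" "int p"] p_dvd_N by (auto simp: U cong_def mod_mod_cancel)
  have "elt c s l = (\<lambda>(c, s, l). elt c s l) (c mod N, s mod N, l mod N)"
    unfolding prod.case by (rule elt_cong) simp_all
  then have "the_inv_into ?D (\<lambda>(c, s, l). elt c s l) (elt c s l) = (c mod N, s mod N, l mod N)"
    using the_inv_into_f_f[OF inj mem] by simp
  then show ?thesis
    using P_dvd_N by (simp add: phi_h_def mod_mod_cancel)
qed

lemma coprime_if_cong_1:
  assumes "[x = 1] (mod P)"
  shows "coprime x (int p)"
  by (rule cong_imp_coprime[OF cong_sym[OF cong_dvd_modulus[OF assms p_dvd_P]]]) simp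

lemma finite_carrier_G: "finite (carrier G)"
proof (rule finite_subset)
  show "carrier G \<subseteq> (\<lambda>(c, s, l). elt c s l) ` (I \<times> I \<times> I)"
  proof
    fix X assume "X \<in> carrier G"
    then obtain c s l where "X = elt c s l" by (auto simp: carrier_G)
    also have "\<dots> = elt (c mod N) (s mod N) (l mod N)" by (rule elt_cong) simp_all
    finally show "X \<in> (\<lambda>(c, s, l). elt c s l) ` (I \<times> I \<times> I)" by force
  qed
qed simp

section \<open>The homomorphism \<open>phi_h\<close>\<close>

lemma comm_group_U: "comm_group U"
  using residues.cring[OF residues.intro, OF P_gt_1] by (simp add: cring.axioms(2) comm_monoid.units_comm_group)

lemma carrier_U: "carrier U = {x. 0 < x \<and> x < P \<and> coprime x (int p)}"
  using P_gt_1 by (simp add: units_of_def units_residue_ring coprime_P_iff del: coprime_power_right_iff)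

lemma mod_P_in_U:
  assumes "coprime l (int p)"
  shows "l mod P \<in> carrier U"
proof -
  have "coprime (l mod P) (int p)"
    using cong_imp_coprime[of l "l mod P" "int p"] assms p_dvd_P by (auto simp: cong_def mod_mod_cancel)
  moreover from this have "l mod P \<noteq> 0"
    using p_gt_1 by auto
  moreover have "l mod P < P" "0 \<le> l mod P"
    using P_gt_1 pos_mod_bound[of P l] pos_mod_sign[of P l] by linarith+
  ultimately show ?thesis
    by (simp add: carrier_U)
qed

text \<open>Modulo p^r the denominator u is 1 and the term p^r c s' vanishes, so the third
  coordinates simply multiply.\<close>

lemma phi_h_hom: "phi_h \<in> hom G U"
proof (rule homI)
  fix X assume "X \<in> carrier G"
  then show "phi_h X \<in> carrier U"
    by (auto simp: carrier_G phi_h_elt mod_P_in_U)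
next
  fix X Y assume "X \<in> carrier G" "Y \<in> carrier G"
  then obtain c s l c' s' l' where X: "X = elt c s l" "coprime l (int p)"
    and Y: "Y = elt c' s' l'" "coprime l' (int p)"
    by (auto simp: carrier_G)
  define u where "u = 1 + P * (s * c')"
  define v where "v = modular_inverse N u"
  have uv: "[u * v = 1] (mod N)"
    unfolding v_def using coprime_1_plus[of "s * c'"]
    by (intro cong_modular_inverse1) (simp add: u_def coprime_N_iff del: coprime_power_right_iff)
  have uvx: "[u * (v * x) = x] (mod N)" for x
    using cong_scalar_right[OF uv, of x] by (simp add: mult.assoc)
  define l'' where "l'' = v * (l * l' + P * c * s')"
  have XY: "X \<otimes>\<^bsub>G\<^esub> Y = elt (v * (c + l * c')) (v * (l' * s + s')) l''"
    unfolding X Y using X Y uvx by (intro elt_mult) (auto simp: u_def l''_def)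
  have "[u * v = 1] (mod P)"
    using uv P_dvd_N by (rule cong_dvd_modulus)
  moreover have "[u = 1] (mod P)" by (simp add: u_def cong_iff_dvd_diff)
  ultimately have "[v = 1] (mod P)"
    by (rule cong_lincomb[where k = 1 and j = "-v"]) (simp add: algebra_simps)
  moreover have "[l * l' + P * c * s' = l * l'] (mod P)"
    by (simp add: cong_iff_dvd_diff)
  ultimately have "[l'' = 1 * (l * l')] (mod P)"
    unfolding l''_def by (rule cong_mult)
  then have l'': "[l'' = l * l'] (mod P)"
    by simp
  then have "[l * l' = l''] (mod int p)"
    using p_dvd_P cong_dvd_modulus cong_sym by blast
  then have "coprime l'' (int p)"
    by (rule cong_imp_coprime) (use X Y in simp)
  then show "phi_h (X \<otimes>\<^bsub>G\<^esub> Y) = phi_h X \<otimes>\<^bsub>U\<^esub> phi_h Y"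
    unfolding XY using X Y l''
    by (simp add: phi_h_elt units_of_def residue_ring_def cong_def mod_simps)
qed

lemma phi_h_surj: "phi_h ` carrier G = carrier U"
proof (intro equalityI subsetI)
  fix x assume x: "x \<in> carrier U"
  then have "phi_h (elt 0 0 x) = x"
    by (simp add: carrier_U phi_h_elt)
  then show "x \<in> phi_h ` carrier G"
    using x by (metis (mono_tags, lifting) carrier_U elt_closed image_eqI mem_Collect_eq)
qed (use phi_h_hom in \<open>auto simp: hom_def\<close>)

lemma phi_h_group_hom: "group_hom G U phi_h"
  using phi_h_hom group_G comm_group_U
  by (simp add: group_hom_def group_hom_axioms_def comm_group_def)

text \<open>Conjugation by the scaling 2, a unit since p is odd, doubles a row shift; the commutator
  is therefore the shift by 2c - c.\<close>

lemma row_shift_in_derived: "elt c 0 1 \<in> derived G (carrier G)"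
proof (rule group.commutatorI[OF group_G, of "elt c 0 1" "elt 0 0 2"])
  have 2: "coprime (2::int) (int p)" using odd_p by simp
  then show "elt c 0 1 \<in> carrier G" "elt 0 0 2 \<in> carrier G" "elt c 0 1 \<in> carrier G"
    by (auto intro: elt_closed)
  have "elt c 0 1 \<otimes>\<^bsub>G\<^esub> elt 0 0 2 = elt c 0 2" "elt c 0 1 \<otimes>\<^bsub>G\<^esub> elt c 0 2 = elt (2 * c) 0 2"
    "elt 0 0 2 \<otimes>\<^bsub>G\<^esub> elt c 0 1 = elt (2 * c) 0 2"
    by (rule elt_mult; use 2 in simp)+
  then show "elt c 0 1 \<otimes>\<^bsub>G\<^esub> (elt c 0 1 \<otimes>\<^bsub>G\<^esub> elt 0 0 2) = elt 0 0 2 \<otimes>\<^bsub>G\<^esub> elt c 0 1"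
    by simp
qed

text \<open>Conjugation by the scaling 2 halves a column shift. Hence the roles are exchanged and
  the shift 2s is used, giving 2s - s.\<close>

lemma column_shift_in_derived: "elt 0 s 1 \<in> derived G (carrier G)"
proof (rule group.commutatorI[OF group_G, of "elt 0 0 2" "elt 0 (2 * s) 1"])
  have 2: "coprime (2::int) (int p)" using odd_p by simp
  then show "elt 0 0 2 \<in> carrier G" "elt 0 (2 * s) 1 \<in> carrier G" "elt 0 s 1 \<in> carrier G"
    by (auto intro: elt_closed)
  have "elt 0 0 2 \<otimes>\<^bsub>G\<^esub> elt 0 (2 * s) 1 = elt 0 (2 * s) 2" "elt 0 s 1 \<otimes>\<^bsub>G\<^esub> elt 0 (2 * s) 2 = elt 0 (4 * s) 2"
    "elt 0 (2 * s) 1 \<otimes>\<^bsub>G\<^esub> elt 0 0 2 = elt 0 (4 * s) 2"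
    by (rule elt_mult; use 2 in simp)+
  then show "elt 0 s 1 \<otimes>\<^bsub>G\<^esub> (elt 0 0 2 \<otimes>\<^bsub>G\<^esub> elt 0 (2 * s) 1) = elt 0 (2 * s) 1 \<otimes>\<^bsub>G\<^esub> elt 0 0 2"
    by simp
qed

lemma diagonal_in_derived:
  assumes "[w = 1] (mod P)"
  shows "elt 0 0 w \<in> derived G (carrier G)"
proof -
  interpret group G by (rule group_G)
  let ?D = "derived G (carrier G)"
  have D: "subgroup ?D G" by (rule derived_is_subgroup) simp
  \<comment> \<open>A square root of w modulo p^q: since w^(p^q) = 1 there, v^2 = w^(p^q + 1) = w.
    The exponent is exact because p is odd.\<close>
  define v where "v = w ^ ((p ^ q + 1) div 2)"
  define u where "u = modular_inverse N v"
  have v1: "[v = 1] (mod P)"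
    using cong_pow[OF assms, of "(p ^ q + 1) div 2"] by (simp add: v_def)
  have uv: "[v * u = 1] (mod N)"
    unfolding u_def using coprime_if_cong_1[OF v1]
    by (intro cong_modular_inverse1) (simp add: coprime_N_iff del: coprime_power_right_iff)
  then have "[v * u = 1] (mod P)"
    using P_dvd_N cong_dvd_modulus by blast
  from this v1 have "[u = 1] (mod P)"
    by (rule cong_lincomb[where k = 1 and j = "-u"]) (simp add: algebra_simps)
  \<comment> \<open>This c makes the denominator of (0, 1, 1)(c, 0, 1) equal to u, the inverse of
    v.\<close>
  then obtain c where c: "u = 1 + P * c"
    by (metis cong_iff_lin cong_sym)
  have w: "[v * v = w] (mod N)"
  proof -
    have "even (p ^ q + 1)" using odd_p by simp
    then have "(p ^ q + 1) div 2 + (p ^ q + 1) div 2 = p ^ q + 1" by presburger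
    then have "v * v = w ^ (p ^ q) * w"
      unfolding v_def by (simp flip: power_add)
    moreover have "[w ^ (p ^ q) = 1] (mod N)"
      using power_cong_1_raise[OF assms r_pos, of q] by (rule cong_dvd_modulus) (simp add: le_imp_power_dvd)
    ultimately show ?thesis using cong_scalar_right[of "w ^ (p ^ q)" 1 N w] by simp
  qed
  have cop: "coprime v (int p)" "coprime w (int p)"
    using v1 assms coprime_if_cong_1 by auto
  have "elt 0 1 1 \<otimes>\<^bsub>G\<^esub> elt c 0 1 = elt (c * v) v v"
    using cong_scalar_right[OF uv, of c] uv
    by (intro elt_mult) (auto simp: c algebra_simps)
  also have "\<dots> = elt (c * v) 0 w \<otimes>\<^bsub>G\<^esub> elt 0 v 1"
  proof -
    have "[v = w + P * (c * v) * v] (mod N)"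
      by (rule cong_lincomb[OF w uv, where k = 1 and j = "-v"]) (simp add: c algebra_simps)
    then show ?thesis
      using cop by (intro elt_mult[symmetric]) simp_all
  qed
  also have "elt (c * v) 0 w = elt (c * v) 0 1 \<otimes>\<^bsub>G\<^esub> elt 0 0 w"
    using cop by (intro elt_mult[symmetric]) simp_all
  finally have "elt (c * v) 0 1 \<otimes>\<^bsub>G\<^esub> elt 0 0 w \<otimes>\<^bsub>G\<^esub> elt 0 v 1 \<in> ?D"
    using row_shift_in_derived column_shift_in_derived subgroup.m_closed[OF D] by metis
  moreover have "elt 0 0 w = inv\<^bsub>G\<^esub> elt (c * v) 0 1 \<otimes>\<^bsub>G\<^esub>
      (elt (c * v) 0 1 \<otimes>\<^bsub>G\<^esub> elt 0 0 w \<otimes>\<^bsub>G\<^esub> elt 0 v 1) \<otimes>\<^bsub>G\<^esub> inv\<^bsub>G\<^esub> elt 0 v 1"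
    using cop elt_closed[of 1] elt_closed[of w] by (simp add: m_assoc inv_solve_left)
  ultimately show ?thesis
    using row_shift_in_derived column_shift_in_derived
    by (metis D subgroup.m_closed subgroup.m_inv_closed)
qed

lemma kernel_phi_h: "kernel G U phi_h = derived G (carrier G)"
proof
  interpret group G by (rule group_G)
  have D: "subgroup (derived G (carrier G)) G" by (rule derived_is_subgroup) simp
  show "kernel G U phi_h \<subseteq> derived G (carrier G)"
  proof
    fix X assume X: "X \<in> kernel G U phi_h"
    then obtain c s l where csl: "X = elt c s l" "coprime l (int p)"
      by (auto simp: kernel_def carrier_G)
    \<comment> \<open>Row shift c, diagonal w and column shift s multiply to third coordinate w +
      p^r c s, which has to be l.\<close>
    define w where "w = l - P * c * s"
    have "[l = 1] (mod P)"
      using X csl P_gt_1 by (simp add: kernel_def phi_h_elt units_of_def residue_ring_def cong_def)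
    then have w: "[w = 1] (mod P)"
      by (rule cong_lincomb[OF _ cong_mult_self_left[of P "c * s"], where k = 1 and j = "-1"]) (simp add: w_def)
    then have "coprime w (int p)"
      by (rule coprime_if_cong_1)
    then have "X = elt c 0 1 \<otimes>\<^bsub>G\<^esub> elt 0 0 w \<otimes>\<^bsub>G\<^esub> elt 0 s 1"
    proof -
      have "elt c 0 1 \<otimes>\<^bsub>G\<^esub> elt 0 0 w = elt c 0 w" "elt c 0 w \<otimes>\<^bsub>G\<^esub> elt 0 s 1 = X"
        unfolding csl
        by (rule elt_mult; use \<open>coprime w (int p)\<close> in \<open>simp add: w_def\<close>)+
      then show ?thesis by simp
    qed
    then show "X \<in> derived G (carrier G)"
      using row_shift_in_derived column_shift_in_derived diagonal_in_derived[OF w] subgroup.m_closed[OF D]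
      by simp
  qed
  show "derived G (carrier G) \<subseteq> kernel G U phi_h"
    by (rule group_hom.derived_subset_kernel[OF phi_h_group_hom comm_group_U])
qed

lemma order_abelianization: "order (abelianization G) = totient (p ^ r)"
proof -
  have "order (abelianization G) = card (carrier U)"
    using iso_same_card[OF group_hom.FactGroup_iso[OF phi_h_group_hom phi_h_surj]]
    by (simp add: abelianization_def order_def kernel_phi_h)
  also have "\<dots> = totient (nat P)"
    using residues.totient_eq[OF residues.intro[OF P_gt_1]] by (simp add: units_of_def)
  finally show ?thesis by (simp add: nat_power_eq)
qed

end

subsection \<open>The two matrices as deformed bicharacters\<close>

definition unit_char :: "nat \<Rightarrow> nat \<Rightarrow> nat \<Rightarrow> ((nat \<Rightarrow> int) set \<Rightarrow> complex) \<Rightarrow> int \<Rightarrow> complex" where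
  "unit_char p r q \<chi> x = \<chi> (principal_unit_class p r q (1 + int p ^ r * x))"

text \<open>The deformed additivity is (1 + p^r x)(1 + p^r y) = 1 + p^r (x + y + p^r x y).
  Faithfulness compares 1 + p^r x and 1 + p^r y modulo p^(q+r); cancelling p^r leaves the modulus
  p^q.\<close>

lemma unit_char_deformed:
  assumes "prime p" "odd p" "1 \<le> r" "r \<le> q"
    and \<chi>: "faithful_character (principal_unit_quotient p r q) \<chi>"
  shows "deformed_bicharacter p r q (unit_char p r q \<chi>)"
proof
  have p: "p > 0" using assms(1) prime_gt_0_nat by blast
  have carrier: "principal_unit_class p r q (1 + int p ^ r * x) \<in> carrier (principal_unit_quotient p r q)" for x
    using p by (intro principal_unit_class_carrier) (simp_all add: cong_iff_dvd_diff)
  show "unit_char p r q \<chi> x * unit_char p r q \<chi> y = unit_char p r q \<chi> (x + y + int p ^ r * x * y)" for x y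
  proof -
    have "\<chi> (A \<otimes>\<^bsub>principal_unit_quotient p r q\<^esub> B) = \<chi> A * \<chi> B"
      if "A \<in> carrier (principal_unit_quotient p r q)" "B \<in> carrier (principal_unit_quotient p r q)" for A B
      using \<chi> that by (auto simp: faithful_character_def hom_def complex_unit_group_def)
    from this[OF carrier carrier, of x y] show ?thesis
      unfolding unit_char_def principal_unit_class_mult[OF p] by (simp add: algebra_simps)
  qed
  show "unit_char p r q \<chi> x = unit_char p r q \<chi> y \<longleftrightarrow> [x = y] (mod int p ^ q)" for x y
  proof -
    have cop: "coprime (1 + int p ^ r * x) (int p)" for x
      by (rule cong_imp_coprime[of 1]) (use assms in \<open>simp_all add: cong_iff_dvd_diff\<close>)
    have "unit_char p r q \<chi> x = unit_char p r q \<chi> y \<longleftrightarrow>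
        principal_unit_class p r q (1 + int p ^ r * x) = principal_unit_class p r q (1 + int p ^ r * y)"
      using \<chi> inj_on_eq_iff[OF _ carrier carrier] unfolding unit_char_def faithful_character_def by blast
    also have "\<dots> \<longleftrightarrow> [1 + int p ^ r * x = 1 + int p ^ r * y] (mod int p ^ (q + r))"
      by (rule principal_unit_class_eq_iff[OF assms(1) cop cop])
    also have "\<dots> \<longleftrightarrow> int p ^ r * int p ^ q dvd int p ^ r * (x - y)"
      unfolding cong_iff_dvd_diff by (simp only: power_add mult.commute[of "int p ^ q"] right_diff_distrib) simp
    also have "\<dots> \<longleftrightarrow> [x = y] (mod int p ^ q)"
      using p by (simp add: cong_iff_dvd_diff)
    finally show ?thesis .
  qed
qed (use assms in auto)

lemma H_matrix_unit_char: "H_matrix p r q \<chi> = (\<lambda>a b. unit_char p r q \<chi> (a * b))"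
  by (simp add: H_matrix_def unit_char_def fun_eq_iff mult.assoc)

section \<open>The character behind the Fourier matrix\<close>

definition fourier_char :: "nat \<Rightarrow> nat \<Rightarrow> int \<Rightarrow> complex" where
  "fourier_char p q x = cis (2 * pi * (of_int x / real (p ^ q)))"

lemma Fourier_matrix_char: "Fourier_matrix p q = (\<lambda>a b. fourier_char p q (a * b))"
  by (simp add: Fourier_matrix_def fourier_char_def fun_eq_iff cis_conv_exp algebra_simps)

lemma fourier_char_add: "fourier_char p q (x + y) = fourier_char p q x * fourier_char p q y"
  by (simp add: fourier_char_def cis_mult add_divide_distrib distrib_left)

lemma fourier_char_eq_iff:
  assumes "p > 0"
  shows "fourier_char p q x = fourier_char p q y \<longleftrightarrow> [x = y] (mod int p ^ q)"
proof -
  have "fourier_char p q z = 1 \<longleftrightarrow> int p ^ q dvd z" for z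
  proof
    assume "fourier_char p q z = 1"
    then have "cos (2 * pi * (of_int z / real (p ^ q))) = 1"
      by (simp add: fourier_char_def complex_eq_iff)
    then obtain n :: int where "2 * pi * (of_int z / real (p ^ q)) = of_int n * 2 * pi"
      using cos_one_2pi_int by blast
    then have "real_of_int z = of_int n * real (p ^ q)"
      using assms by (simp add: field_simps)
    also have "\<dots> = of_int (n * int p ^ q)" by simp
    finally have "z = n * int p ^ q" by linarith
    then show "int p ^ q dvd z" by simp
  next
    assume "int p ^ q dvd z"
    then obtain k where "z = int p ^ q * k" ..
    then have "of_int z / real (p ^ q) = of_int k" using assms by simp
    then show "fourier_char p q z = 1"
      by (simp only: fourier_char_def) (rule cis_multiple_2pi, simp)
  qed
  moreover have "fourier_char p q x = fourier_char p q (x - y) * fourier_char p q y"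
    by (simp flip: fourier_char_add)
  moreover have "fourier_char p q y \<noteq> 0" by (simp add: fourier_char_def)
  ultimately show ?thesis by (simp add: cong_iff_dvd_diff)
qed

lemma fourier_char_deformed:
  assumes "prime p" "odd p" "1 \<le> q"
  shows "deformed_bicharacter p q q (fourier_char p q)"
proof
  have p: "p > 0" using assms(1) prime_gt_0_nat by blast
  show "fourier_char p q x * fourier_char p q y = fourier_char p q (x + y + int p ^ q * x * y)" for x y
    by (simp add: fourier_char_eq_iff[OF p] cong_iff_dvd_diff flip: fourier_char_add)
qed (use assms fourier_char_eq_iff prime_gt_0_nat in auto)

section \<open>Monomial inequivalence\<close>

lemma monomially_equivalentE:
  assumes "finite I" "monomially_equivalent I H K"
  obtains \<pi> \<sigma> d\<^sub>1 d\<^sub>2 where "\<pi> permutes I" "\<sigma> permutes I"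
    "\<And>a. a \<in> I \<Longrightarrow> d\<^sub>1 a \<noteq> 0" "\<And>b. b \<in> I \<Longrightarrow> d\<^sub>2 b \<noteq> 0"
    "\<And>a b. a \<in> I \<Longrightarrow> b \<in> I \<Longrightarrow> K a b = d\<^sub>1 a * H (\<pi> a) (\<sigma> b) * d\<^sub>2 b"
proof -
  obtain \<pi> \<tau> d\<^sub>1 d\<^sub>2 where perm: "\<pi> permutes I" "\<tau> permutes I"
    and d: "\<forall>a\<in>I. cmod (d\<^sub>1 a) = 1" "\<forall>b\<in>I. cmod (d\<^sub>2 b) = 1"
    and K: "\<And>a b. a \<in> I \<Longrightarrow> b \<in> I \<Longrightarrow> K a b = mat_prod I (diag_matrix d\<^sub>1)
        (mat_prod I (perm_matrix \<pi>) (mat_prod I H (mat_prod I (perm_matrix \<tau>) (diag_matrix d\<^sub>2)))) a b"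
    using assms(2) by (auto simp: monomially_equivalent_def)
  \<comment> \<open>A permutation matrix on the right selects the column c with \<tau> c = b, so
    column indices move by the inverse permutation.\<close>
  define \<sigma> where "\<sigma> = inv_into UNIV \<tau>"
  have \<sigma>: "\<sigma> permutes I" using perm by (simp add: \<sigma>_def permutes_inv)
  have perm_mult: "mat_prod I (perm_matrix f) M a b = M (f a) b" if "f permutes I" "a \<in> I"
    for f and M :: "'a \<Rightarrow> 'a \<Rightarrow> complex" and a b
    using that assms(1) permutes_in_image[OF that(1), of a]
    by (simp add: mat_prod_def perm_matrix_def if_distrib[of "\<lambda>x. x * _"] cong: if_cong)
  have diag_mult: "mat_prod I (diag_matrix f) M a b = f a * M a b" if "a \<in> I"
    for f and M :: "'a \<Rightarrow> 'a \<Rightarrow> complex" and a b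
    using that assms(1)
    by (simp add: mat_prod_def diag_matrix_def if_distrib[of "\<lambda>x. x * _"] cong: if_cong)
  have "mat_prod I H (mat_prod I (perm_matrix \<tau>) (diag_matrix d\<^sub>2)) x b = H x (\<sigma> b) * d\<^sub>2 b" if "b \<in> I" for x b
  proof -
    have "mat_prod I H (mat_prod I (perm_matrix \<tau>) (diag_matrix d\<^sub>2)) x b =
        (\<Sum>c\<in>I. H x c * diag_matrix d\<^sub>2 (\<tau> c) b)"
      unfolding mat_prod_def[of I H] by (intro sum.cong refl) (simp add: perm_mult[OF perm(2)])
    also have "\<dots> = (\<Sum>c\<in>I. if c = \<sigma> b then H x c * d\<^sub>2 b else 0)"
      by (intro sum.cong refl)
        (auto simp: diag_matrix_def \<sigma>_def permutes_inverses[OF perm(2)])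
    also have "\<dots> = H x (\<sigma> b) * d\<^sub>2 b"
      using that assms(1) permutes_in_image[OF \<sigma>, of b] by simp
    finally show ?thesis .
  qed
  then have "K a b = d\<^sub>1 a * H (\<pi> a) (\<sigma> b) * d\<^sub>2 b" if "a \<in> I" "b \<in> I" for a b
    using that by (simp add: K diag_mult perm_mult[OF perm(1)])
  moreover have "d\<^sub>1 a \<noteq> 0" "d\<^sub>2 a \<noteq> 0" if "a \<in> I" for a
    using d that by auto
  ultimately show ?thesis
    using that perm(1) \<sigma> by blast
qed

lemma (in deformed_bicharacter) not_equivalent_Fourier:
  assumes "r < q"
  shows "\<not> monomially_equivalent I H (Fourier_matrix p q)"
proof
  assume "monomially_equivalent I H (Fourier_matrix p q)"
  then obtain \<pi> \<sigma> d\<^sub>1 d\<^sub>2 where perm: "\<pi> permutes I" "\<sigma> permutes I"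
    and d: "\<And>a. a \<in> I \<Longrightarrow> d\<^sub>1 a \<noteq> 0" "\<And>b. b \<in> I \<Longrightarrow> d\<^sub>2 b \<noteq> 0"
    and F: "\<And>a b. a \<in> I \<Longrightarrow> b \<in> I \<Longrightarrow> Fourier_matrix p q a b = d\<^sub>1 a * h (\<pi> a * \<sigma> b) * d\<^sub>2 b"
    using I_simps(4) by (elim monomially_equivalentE[rotated]) blast+
  define e where "e = fourier_char p q"
  have e_add: "e (x + y) = e x * e y" for x y by (simp add: e_def fourier_char_add)
  have e_nz: "e x \<noteq> 0" for x by (simp add: e_def fourier_char_def)
  have e_eq_iff: "e x = e y \<longleftrightarrow> [x = y] (mod N)" for x y
    using p_gt_1 by (simp add: e_def fourier_char_eq_iff)
  have eF: "e (a * b) = d\<^sub>1 a * h (\<pi> a * \<sigma> b) * d\<^sub>2 b" if "a \<in> I" "b \<in> I" for a b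
    using F[OF that] by (simp add: Fourier_matrix_char e_def)
  have surj: "\<exists>a\<in>I. f a = x" if "f permutes I" "x \<in> I" for f x
  proof -
    have "x \<in> f ` I"
      using that(2) unfolding permutes_image[OF that(1)] .
    then show ?thesis by auto
  qed
  obtain a0 b0 where a0: "a0 \<in> I" "\<pi> a0 = 0" and b0: "b0 \<in> I" "\<sigma> b0 = 0"
    using surj perm I_simps(1) by meson
  \<comment> \<open>Row 0 and column 0 of \<open>H\<close> consist of ones, so comparing the four
    entries at a, a0 and b, b0 cancels all diagonal factors.\<close>
  have key: "h (\<pi> a * \<sigma> b) = e ((a - a0) * (b - b0))" if ab: "a \<in> I" "b \<in> I" for a b
  proof -
    have "(d\<^sub>1 a * d\<^sub>2 b * d\<^sub>1 a0 * d\<^sub>2 b0) * h (\<pi> a * \<sigma> b) = e (a * b) * e (a0 * b0)"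
      using ab a0 b0 by (simp add: eF h_0)
    also have "\<dots> = e ((a - a0) * (b - b0)) * (e (a * b0) * e (a0 * b))"
      by (simp add: algebra_simps flip: e_add)
    also have "e (a * b0) * e (a0 * b) = d\<^sub>1 a * d\<^sub>2 b * d\<^sub>1 a0 * d\<^sub>2 b0"
      using ab a0 b0 by (simp add: eF h_0)
    finally show ?thesis
      using d ab a0 b0 by simp
  qed
  obtain a1 where a1: "a1 \<in> I" "\<pi> a1 = 1"
    using surj[OF perm(1) I_simps(2)] by blast
  \<comment> \<open>The index 2 a1 - a0 lies twice as far from a0 as a1 does, so row X of
    \<open>H\<close> is the entrywise square of row 1.\<close>
  define X where "X = \<pi> ((2 * a1 - a0) mod N)"
  have Xy: "[X * y = y + y + P * y * y] (mod N)" if y: "y \<in> I" for y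
  proof -
    obtain b where b: "b \<in> I" "\<sigma> b = y" using surj[OF perm(2) y] by blast
    have "h (X * y) = e (((2 * a1 - a0) mod N - a0) * (b - b0))"
      unfolding X_def using key[OF _ b(1)] b(2) by simp
    also have "\<dots> = e ((2 * a1 - a0 - a0) * (b - b0))"
      unfolding e_eq_iff by (intro cong_mult cong_diff) simp_all
    also have "\<dots> = e ((a1 - a0) * (b - b0)) * e ((a1 - a0) * (b - b0))"
      by (simp add: algebra_simps flip: e_add)
    also have "\<dots> = h y * h y"
      using key[OF a1(1) b(1)] a1 b by simp
    finally show ?thesis by (simp add: h_mult h_eq_iff)
  qed
  \<comment> \<open>Oddness of p is needed for 2 to be a column index and, below, for cancelling
    2.\<close>
  have "p \<noteq> 2" using odd_p by auto
  then have "int p ^ 1 \<ge> 3" using p_gt_1 by simp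
  moreover have "int p ^ 1 \<le> N" using p_gt_1 q_pos by (intro power_increasing) auto
  ultimately have "2 < N" by linarith
  then have "2 \<in> I" by (simp add: I_eq)
  \<comment> \<open>Eliminating X: y = 2 gives 2X = 4 + 4 p^r, while twice y = 1 gives 2X = 4 + 2
    p^r.\<close>
  from Xy[OF this] Xy[OF I_simps(2)] have "[2 * P = 2 * 0] (mod N)"
    by (rule cong_lincomb[where k = "-1" and j = 2]) (simp add: algebra_simps)
  moreover have "coprime 2 N" using odd_p by simp
  ultimately have "N dvd P"
    by (simp only: cong_mult_lcancel cong_0_iff)
  then show False
    using zdvd_imp_le[of N P] power_strict_increasing[of r q "int p"] assms p_gt_1 P_gt_1 by linarith
qed

section \<open>Transfer to \<open>phi\<close>, \<open>M_group\<close> and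
  \<open>F_group\<close>\<close>

lemma (in deformed_bicharacter) M_element_eq:
  assumes "H_matrix p r q \<chi> = H"
  shows "M_element p r q \<chi> (c, s, l) = elt c s l"
  by (simp add: M_element_def elt_def quad_def assms)

lemma (in deformed_bicharacter) phi_eq:
  assumes "H_matrix p r q \<chi> = H"
  shows "phi p r q \<chi> = phi_h"
proof -
  have "M_element p r q \<chi> = (\<lambda>(c, s, l). elt c s l)"
    using M_element_eq[OF assms] by auto
  then show ?thesis
    by (intro ext) (simp add: phi_def M_coords_def phi_h_def)
qed

theorem theorem6p2:
  fixes p r q :: nat and \<chi> :: "(nat \<Rightarrow> int) set \<Rightarrow> complex"
  assumes "prime p" and "odd p" and "r \<ge> 1" and "q \<ge> 1"
    and "faithful_character (principal_unit_quotient p r q) \<chi>"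
  shows
    "(r \<le> q \<longrightarrow>
        phi p r q \<chi> \<in> epi (M_group p r q \<chi>) (units_of (residue_ring (int p ^ r))) \<and>
        kernel (M_group p r q \<chi>) (units_of (residue_ring (int p ^ r))) (phi p r q \<chi>) =
          derived (M_group p r q \<chi>) (carrier (M_group p r q \<chi>)) \<and>
        order (abelianization (M_group p r q \<chi>)) = totient (p ^ r) \<and>
        totient (p ^ r) = p ^ (r - 1) * (p - 1)) \<and>
     order (abelianization (F_group p q)) = p ^ (q - 1) * (p - 1) \<and>
     (r < q \<longrightarrow>
        \<not> M_group p r q \<chi> \<cong> F_group p q \<and>
        \<not> monomially_equivalent (res_set p q) (H_matrix p r q \<chi>) (Fourier_matrix p q))"
proof -
  \<comment> \<open>The Fourier character has deformation exponent q, so the general count is used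
    with q in place of r.\<close>
  have F: "order (abelianization (F_group p q)) = p ^ (q - 1) * (p - 1)"
    using deformed_bicharacter.order_abelianization[OF fourier_char_deformed[OF assms(1,2,4)]] assms
    by (simp add: F_group_def Fourier_matrix_char totient_prime_power)
  have tot: "totient (p ^ r) = p ^ (r - 1) * (p - 1)"
    using assms by (simp add: totient_prime_power)
  have M: "M_group p r q \<chi> = projective_monomial_group (res_set p q) (\<lambda>a b. unit_char p r q \<chi> (a * b))"
    by (simp add: M_group_def H_matrix_unit_char)
  have "phi p r q \<chi> \<in> epi (M_group p r q \<chi>) (units_of (residue_ring (int p ^ r)))"
    "kernel (M_group p r q \<chi>) (units_of (residue_ring (int p ^ r))) (phi p r q \<chi>) =
      derived (M_group p r q \<chi>) (carrier (M_group p r q \<chi>))"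
    "order (abelianization (M_group p r q \<chi>)) = totient (p ^ r)"
    "r < q \<Longrightarrow> \<not> monomially_equivalent (res_set p q) (H_matrix p r q \<chi>) (Fourier_matrix p q)"
    "finite (carrier (M_group p r q \<chi>))"
    if "r \<le> q"
  proof -
    interpret deformed_bicharacter p r q "unit_char p r q \<chi>"
      using unit_char_deformed assms that by blast
    note phi = phi_eq[OF H_matrix_unit_char]
    show "phi p r q \<chi> \<in> epi (M_group p r q \<chi>) (units_of (residue_ring (int p ^ r)))"
      using phi_h_hom phi_h_surj by (simp add: M phi epi_def)
    show "kernel (M_group p r q \<chi>) (units_of (residue_ring (int p ^ r))) (phi p r q \<chi>) =
        derived (M_group p r q \<chi>) (carrier (M_group p r q \<chi>))"
      by (simp add: M phi kernel_phi_h)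
    show "order (abelianization (M_group p r q \<chi>)) = totient (p ^ r)"
      by (simp add: M order_abelianization)
    show "r < q \<Longrightarrow> \<not> monomially_equivalent (res_set p q) (H_matrix p r q \<chi>) (Fourier_matrix p q)"
      using not_equivalent_Fourier by (simp add: H_matrix_unit_char)
    show "finite (carrier (M_group p r q \<chi>))"
      by (simp add: M finite_carrier_G)
  qed
  note M_facts = this
  have "\<not> M_group p r q \<chi> \<cong> F_group p q" if "r < q"
  proof
    assume "M_group p r q \<chi> \<cong> F_group p q"
    then have "p ^ (r - 1) * (p - 1) = p ^ (q - 1) * (p - 1)"
      using order_abelianization_iso[of "M_group p r q \<chi>" "F_group p q"] M_facts(3,5) that F tot
      by (simp add: M_group_def F_group_def group_projective_monomial_group)
    then have "p ^ (r - 1) = p ^ (q - 1)"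
      using prime_gt_1_nat[OF assms(1)] by simp
    then have "r - 1 = q - 1"
      using prime_gt_1_nat[OF assms(1)] power_inject_exp by blast
    then show False using that assms(3) by simp
  qed
  then show ?thesis
    using M_facts F tot by auto
qed

end
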